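(* Let $A$ and $B$ be positive trace class operators on a Hilbert space and let $1\le p\le 2$. For $0\le t\le 1$ put $\mu_p(A,B,t)=(tA^p+(1-t)B^p)^{1/p}$. Then the function $t\mapsto \operatorname{Tr}\big[(A-\mu_p(A,B,t))^2\big]$ is monotonically decreasing (in the non-strict sense) on $[0,1]$.
   Context: "Positive" means self-adjoint and positive semidefinite. Powers of positive operators are defined by functional calculus. The operator $\mu_p(A,B,t)$ is called the weighted $p$-power mean of $A$ and $B$. *)

theory Defs
  imports "HOL-Analysis.Analysis" "HOL-Computational_Algebra.Polynomial"
begin

(* A complex Hilbert space is a complete real inner product space whose real structure is the
   underlying one of a complex structure: the real scalar multiplication is the restriction of
   scaleC, and the real inner product is the real part of cinner.  Positive definiteness of cinner
   and completeness in its norm are inherited from real_inner and complete_space.  The form is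
   linear in the second argument and conjugate-linear in the first. *)
class complex_hilbert_space = real_inner + complete_space +
  fixes scaleC :: "complex \<Rightarrow> 'a \<Rightarrow> 'a"  (infixr \<open>*\<^sub>C\<close> 75)
    and cinner :: "'a \<Rightarrow> 'a \<Rightarrow> complex"
  assumes scaleC_add_right: "c *\<^sub>C (x + y) = c *\<^sub>C x + c *\<^sub>C y"
    and scaleC_add_left: "(c + d) *\<^sub>C x = c *\<^sub>C x + d *\<^sub>C x"
    and scaleC_scaleC: "c *\<^sub>C d *\<^sub>C x = (c * d) *\<^sub>C x"
    and scaleR_eq_scaleC: "r *\<^sub>R x = complex_of_real r *\<^sub>C x"
    and cinner_commute: "cinner x y = cnj (cinner y x)"
    and cinner_add_right: "cinner x (y + z) = cinner x y + cinner x z"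
    and cinner_scaleC_right: "cinner x (c *\<^sub>C y) = c * cinner x y"
    and inner_eq_Re_cinner: "inner x y = Re (cinner x y)"

(* Elements of the type 'a \<Rightarrow>\<^sub>L 'a are only real linear; clinear_op singles out the
   bounded operators of the complex Hilbert space, normed by the operator norm. *)
definition clinear_op :: "('a::complex_hilbert_space \<Rightarrow>\<^sub>L 'a) \<Rightarrow> bool" where
  "clinear_op T \<longleftrightarrow> (\<forall>c x. T (c *\<^sub>C x) = c *\<^sub>C T x)"

definition adjoint_op ::
    "('a::complex_hilbert_space \<Rightarrow>\<^sub>L 'a) \<Rightarrow> ('a \<Rightarrow>\<^sub>L 'a)" where
  "adjoint_op T = (THE S :: 'a \<Rightarrow>\<^sub>L 'a. \<forall>x y. cinner (T x) y = cinner x (S y))"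

definition selfadjoint_op :: "('a::complex_hilbert_space \<Rightarrow>\<^sub>L 'a) \<Rightarrow> bool" where
  "selfadjoint_op T \<longleftrightarrow> clinear_op T \<and> (\<forall>x y. cinner (T x) y = cinner x (T y))"

definition positive_op :: "('a::complex_hilbert_space \<Rightarrow>\<^sub>L 'a) \<Rightarrow> bool" where
  "positive_op T \<longleftrightarrow> selfadjoint_op T \<and> (\<forall>x. 0 \<le> Re (cinner x (T x)))"

(* The inverse S is required to be bounded; it is automatically complex linear if T is. *)
definition op_spectrum :: "('a::complex_hilbert_space \<Rightarrow>\<^sub>L 'a) \<Rightarrow> complex set" where
  "op_spectrum T = {z. \<not> (\<exists>S :: 'a \<Rightarrow>\<^sub>L 'a.
     \<forall>x. S (T x - z *\<^sub>C x) = x \<and> T (S x) - z *\<^sub>C S x = x)}"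

definition op_power :: "('a::complex_hilbert_space \<Rightarrow>\<^sub>L 'a) \<Rightarrow> nat \<Rightarrow> ('a \<Rightarrow>\<^sub>L 'a)" where
  "op_power T n = ((o\<^sub>L) T ^^ n) id_blinfun"

definition op_poly :: "real poly \<Rightarrow> ('a::complex_hilbert_space \<Rightarrow>\<^sub>L 'a) \<Rightarrow> ('a \<Rightarrow>\<^sub>L 'a)" where
  "op_poly q T = (\<Sum>i\<le>degree q. coeff q i *\<^sub>R op_power T i)"

(* Continuous functional calculus of a self-adjoint operator: f(T) is the operator norm limit of
   q n (T) for every sequence of polynomials q n converging to f uniformly on the spectrum of T,
   which is a compact set of reals.  Such sequences exist if f is continuous on the spectrum. *)
definition op_fun :: "(real \<Rightarrow> real) \<Rightarrow> ('a::complex_hilbert_space \<Rightarrow>\<^sub>L 'a) \<Rightarrow> ('a \<Rightarrow>\<^sub>L 'a)" where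
  "op_fun f T = (THE F. \<forall>q :: nat \<Rightarrow> real poly.
     uniform_limit {r. complex_of_real r \<in> op_spectrum T} (\<lambda>n. poly (q n)) f sequentially
       \<longrightarrow> (\<lambda>n. op_poly (q n) T) \<longlonglongrightarrow> F)"

(* For positive T and s > 0; note 0 powr s = 0, so powr is continuous on the spectrum. *)
definition op_powr :: "('a::complex_hilbert_space \<Rightarrow>\<^sub>L 'a) \<Rightarrow> real \<Rightarrow> ('a \<Rightarrow>\<^sub>L 'a)" where
  "op_powr T s = op_fun (\<lambda>r. r powr s) T"

definition op_abs :: "('a::complex_hilbert_space \<Rightarrow>\<^sub>L 'a) \<Rightarrow> ('a \<Rightarrow>\<^sub>L 'a)" where
  "op_abs T = op_fun sqrt (adjoint_op T o\<^sub>L T)"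

(* Orthonormal basis = maximal orthonormal set. *)
definition onb :: "'a::complex_hilbert_space set \<Rightarrow> bool" where
  "onb E \<longleftrightarrow> (\<forall>e\<in>E. norm e = 1) \<and> (\<forall>e\<in>E. \<forall>f\<in>E. e \<noteq> f \<longrightarrow> cinner e f = 0)
     \<and> (\<forall>x. (\<forall>e\<in>E. cinner e x = 0) \<longrightarrow> x = 0)"

(* The sum is unordered, so the space need not be separable.  Its value does not depend on the
   basis, so asking for one basis is the same as asking for all. *)
definition trace_class :: "('a::complex_hilbert_space \<Rightarrow>\<^sub>L 'a) \<Rightarrow> bool" where
  "trace_class T \<longleftrightarrow>
     clinear_op T \<and> (\<exists>E. onb E \<and> (\<lambda>e. cinner e (op_abs T e)) summable_on E)"

(* The trace of a trace class operator: the common value of the sums over all bases. *)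
definition op_trace :: "('a::complex_hilbert_space \<Rightarrow>\<^sub>L 'a) \<Rightarrow> complex" where
  "op_trace T = (THE c. \<forall>E. onb E \<longrightarrow> ((\<lambda>e. cinner e (T e)) has_sum c) E)"

definition power_mean ::
    "real \<Rightarrow> ('a::complex_hilbert_space \<Rightarrow>\<^sub>L 'a) \<Rightarrow> ('a \<Rightarrow>\<^sub>L 'a) \<Rightarrow> real \<Rightarrow> ('a \<Rightarrow>\<^sub>L 'a)" where
  "power_mean p A B t = op_powr (t *\<^sub>R op_powr A p + (1 - t) *\<^sub>R op_powr B p) (1 / p)"

end

(* Put q = 1/p and X(t) = t A^p + (1 - t) B^p.  Expanding the square,
   Tr (A - X^q)^2 = Tr A^2 - 2 Tr (A X^q) + Tr X^(2q), and this is convex in X: the power q lies in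
   [1/2, 1] and is operator concave, the power 2q lies in [1, 2] and is operator convex.  Since X is
   affine in t, the function of the theorem is convex on [0, 1]; it is nonnegative and vanishes at
   t = 1 because X(1)^q = A, so it decreases.

   Operator concavity of x^s for 0 < s < 1 reduces to that of x / (x + u), where
   <v, u T (T + u)^(-1) v> = inf_w <w, T w> + u |v - w|^2 is an infimum of functions affine in T.
   The reduction needs no integral: with h > 1, the function G(x) = sum_k h^(k s) x / (x + h^k),
   k over the integers, is increasing and satisfies G(h x) = h^s G(x), so G(x) / G(1) agrees with
   x^s up to a factor between h^(-s) and h^s.  Convexity of x^(1 + s) follows from the same sums
   through x^2 / (x + u) = x - u x / (x + u). *)

theory Submission
  imports Defs "HOL-Computational_Algebra.Fundamental_Theorem_Algebra"
begin

section \<open>Complex Hilbert spaces and coercive operators\<close>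

\<comment> \<open>Operator concavity and convexity compare quadratic forms at a single vector, while
  the trace sums over a basis. So everything is summed over one fixed orthonormal basis, and the
  only traces evaluated are those of squares of self-adjoint operators, that is, squared
  Hilbert-Schmidt norms. The inequality between the summands holds vector by vector up to the term
  \<open>inner (A e) (D e)\<close>, where \<open>D\<close> is the concavity defect of the power
  \<open>q\<close>. This term can be negative at some \<open>e\<close> although \<open>A\<close> and
  \<open>D\<close> are positive; only its sum has a sign. The remedy is to write \<open>A\<close> as
  the square of its root \<open>C\<close>, which is Hilbert-Schmidt because \<open>A\<close> is
  trace class, and to move one factor cyclically, which gives the nonnegative terms
  \<open>inner (C e) (D (C e))\<close>.

  Of the convexity only the chords ending at \<open>t = 1\<close> are used.

  The functional calculus is a definite description, so its existence has to be earned first: the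
  norm of \<open>q(T)\<close> is bounded by the maximum of |q| on the spectrum, and the spectrum of
  a positive operator is located in \<open>{0..norm T}\<close>.\<close>
subclass (in complex_hilbert_space) banach ..

section \<open>Algebra and continuity of the complex inner product\<close>

lemma cinner_add_left: "cinner (x + y) z = cinner x z + cinner y z"
  for x y z :: "'a::complex_hilbert_space"
  by (metis cinner_add_right cinner_commute complex_cnj_add)

lemma cinner_scaleC_left: "cinner (c *\<^sub>C x) y = cnj c * cinner x y"
  for x y :: "'a::complex_hilbert_space"
  by (metis cinner_commute cinner_scaleC_right complex_cnj_mult)

lemma cinner_scaleR_right: "cinner x (r *\<^sub>R y) = of_real r * cinner x y"
  for x y :: "'a::complex_hilbert_space"
  by (simp add: scaleR_eq_scaleC cinner_scaleC_right)

lemma cinner_scaleR_left: "cinner (r *\<^sub>R x) y = of_real r * cinner x y"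
  for x y :: "'a::complex_hilbert_space"
  by (simp add: scaleR_eq_scaleC cinner_scaleC_left)

lemma cinner_zero [simp]:
  "cinner x 0 = 0" "cinner 0 x = 0" for x :: "'a::complex_hilbert_space"
  by (metis add_cancel_right_right cinner_add_right)
     (metis add_cancel_right_right cinner_add_left)

lemma cinner_minus_right: "cinner x (- y) = - cinner x y"
  for x y :: "'a::complex_hilbert_space"
  by (metis cinner_add_right cinner_zero(1) eq_neg_iff_add_eq_0 add.commute right_minus)

lemma cinner_minus_left: "cinner (- x) y = - cinner x y"
  for x y :: "'a::complex_hilbert_space"
  by (metis cinner_commute cinner_minus_right complex_cnj_minus)

lemma cinner_diff_right: "cinner x (y - z) = cinner x y - cinner x z"
  for x y z :: "'a::complex_hilbert_space"
  using cinner_add_right[of x y "- z"] by (simp add: cinner_minus_right)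

lemma cinner_diff_left: "cinner (x - y) z = cinner x z - cinner y z"
  for x y z :: "'a::complex_hilbert_space"
  using cinner_add_left[of x "- y" z] by (simp add: cinner_minus_left)

lemma cinner_sum_right: "cinner x (sum f F) = (\<Sum>i\<in>F. cinner x (f i))"
  for x :: "'a::complex_hilbert_space"
  by (induction F rule: infinite_finite_induct) (auto simp: cinner_add_right)

lemma scaleC_zero_right [simp]: "c *\<^sub>C 0 = (0 :: 'a::complex_hilbert_space)"
  by (metis add_cancel_right_right scaleC_add_right)

lemma scaleC_minus_right: "c *\<^sub>C (- x) = - (c *\<^sub>C x)" for x :: "'a::complex_hilbert_space"
  by (metis add.commute eq_neg_iff_add_eq_0 right_minus scaleC_add_right scaleC_zero_right)

lemma scaleC_diff_right: "c *\<^sub>C (x - y) = c *\<^sub>C x - c *\<^sub>C y"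
  for x y :: "'a::complex_hilbert_space"
  using scaleC_add_right[of c x "- y"] by (simp add: scaleC_minus_right)

lemma scaleC_one [simp]: "1 *\<^sub>C x = x" for x :: "'a::complex_hilbert_space"
  using scaleR_eq_scaleC[of 1 x] by simp

lemma scaleC_zero_left [simp]: "0 *\<^sub>C x = 0" for x :: "'a::complex_hilbert_space"
  using scaleR_eq_scaleC[of 0 x] by simp

lemma scaleC_minus_left: "(- c) *\<^sub>C x = - (c *\<^sub>C x)" for x :: "'a::complex_hilbert_space"
  by (metis add.commute eq_neg_iff_add_eq_0 right_minus scaleC_add_left scaleC_zero_left)

lemma cinner_self: "cinner x x = of_real ((norm x)\<^sup>2)" for x :: "'a::complex_hilbert_space"
proof -
  have "cinner x x \<in> \<real>"
    using cinner_commute[of x x] by (metis Reals_cnj_iff)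
  then show ?thesis
    by (metis inner_eq_Re_cinner of_real_Re dot_square_norm)
qed

lemma norm_scaleC: "norm (c *\<^sub>C x) = cmod c * norm x" for x :: "'a::complex_hilbert_space"
proof -
  have "complex_of_real ((norm (c *\<^sub>C x))\<^sup>2) = (cnj c * c) * cinner x x"
    unfolding cinner_self[symmetric] by (simp add: cinner_scaleC_left cinner_scaleC_right)
  also have "\<dots> = of_real ((cmod c * norm x)\<^sup>2)"
    by (simp add: cinner_self power_mult_distrib mult.commute[of "cnj c"]
        flip: complex_norm_square)
  finally have "(norm (c *\<^sub>C x))\<^sup>2 = (cmod c * norm x)\<^sup>2"
    using of_real_eq_iff by blast
  then show ?thesis by simp
qed

lemma cinner_Cauchy_Schwarz: "cmod (cinner x y) \<le> norm x * norm y"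
  for x y :: "'a::complex_hilbert_space"
proof (cases "cinner x y = 0")
  case False
  define c where "c = cnj (sgn (cinner x y))"
  have c: "cmod c = 1" "c * cinner x y = of_real (cmod (cinner x y))"
    using False complex_norm_square[of "cinner x y"]
    by (simp_all add: c_def sgn_eq norm_divide power2_eq_square mult.commute[of "cnj _"] divide_simps)
  then have "cmod (cinner x y) = Re (cinner x (c *\<^sub>C y))"
    by (simp add: cinner_scaleC_right)
  also have "\<dots> \<le> norm x * norm (c *\<^sub>C y)"
    by (metis inner_eq_Re_cinner norm_cauchy_schwarz)
  finally show ?thesis by (simp add: norm_scaleC c)
qed auto

lemma bounded_linear_cinner_right: "bounded_linear (cinner x)"
  for x :: "'a::complex_hilbert_space"
  by (intro bounded_linear_intro[where K = "norm x"])
     (auto simp: cinner_add_right cinner_scaleR_right scaleR_conv_of_real mult.commute[of "norm _" "norm x"]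
       intro: cinner_Cauchy_Schwarz)

lemma bounded_linear_cinner_left: "bounded_linear (\<lambda>x. cinner x y)"
  for y :: "'a::complex_hilbert_space"
  by (intro bounded_linear_intro[where K = "norm y"])
     (auto simp: cinner_add_left cinner_scaleR_left scaleR_conv_of_real
       intro: cinner_Cauchy_Schwarz)

lemma bounded_linear_scaleC: "bounded_linear (\<lambda>x. c *\<^sub>C x)"
  for c :: complex
  by (intro bounded_linear_intro[where K = "cmod c"])
     (auto simp: scaleC_add_right scaleR_eq_scaleC scaleC_scaleC norm_scaleC mult.commute)

section \<open>Self-adjoint and positive operators\<close>

lemma selfadjoint_opD: "selfadjoint_op T \<Longrightarrow> cinner (T x) y = cinner x (T y)"
  by (simp add: selfadjoint_op_def)

lemma selfadjoint_op_inner: "selfadjoint_op T \<Longrightarrow> inner (T x) y = inner x (T y)"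
  by (simp add: inner_eq_Re_cinner selfadjoint_opD)

lemma selfadjoint_op_scaleC: "selfadjoint_op T \<Longrightarrow> T (c *\<^sub>C x) = c *\<^sub>C T x"
  by (simp add: selfadjoint_op_def clinear_op_def)

lemma selfadjoint_op_cinner_self:
  assumes "selfadjoint_op T"
  shows "cinner x (T x) = of_real (inner x (T x))"
proof -
  have "cinner x (T x) \<in> \<real>"
    using cinner_commute[of x "T x"] selfadjoint_opD[OF assms, of x x] by (metis Reals_cnj_iff)
  then show ?thesis by (metis inner_eq_Re_cinner of_real_Re)
qed

lemma positive_op_imp_selfadjoint: "positive_op T \<Longrightarrow> selfadjoint_op T"
  by (simp add: positive_op_def)

lemma positive_op_inner: "positive_op T \<Longrightarrow> 0 \<le> inner x (T x)"
  by (simp add: positive_op_def inner_eq_Re_cinner)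

lemma positive_opI: "selfadjoint_op T \<Longrightarrow> (\<And>x. 0 \<le> inner x (T x)) \<Longrightarrow> positive_op T"
  by (simp add: positive_op_def inner_eq_Re_cinner)

lemma selfadjoint_op_add: "selfadjoint_op S \<Longrightarrow> selfadjoint_op T \<Longrightarrow> selfadjoint_op (S + T)"
  by (simp add: selfadjoint_op_def clinear_op_def plus_blinfun.rep_eq scaleC_add_right
      cinner_add_left cinner_add_right)

lemma selfadjoint_op_diff: "selfadjoint_op S \<Longrightarrow> selfadjoint_op T \<Longrightarrow> selfadjoint_op (S - T)"
  by (simp add: selfadjoint_op_def clinear_op_def minus_blinfun.rep_eq scaleC_diff_right
      cinner_diff_left cinner_diff_right)

lemma selfadjoint_op_scaleR: "selfadjoint_op T \<Longrightarrow> selfadjoint_op (r *\<^sub>R T)"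
  by (simp add: selfadjoint_op_def clinear_op_def scaleR_blinfun.rep_eq cinner_scaleR_left
      cinner_scaleR_right) (simp add: scaleR_eq_scaleC scaleC_scaleC mult.commute)

lemma selfadjoint_op_id: "selfadjoint_op id_blinfun"
  by (simp add: selfadjoint_op_def clinear_op_def)

lemma selfadjoint_op_compose_commuting:
  assumes "selfadjoint_op S" "selfadjoint_op T" "S o\<^sub>L T = T o\<^sub>L S"
  shows "selfadjoint_op (S o\<^sub>L T)"
  using assms by (auto simp: selfadjoint_op_def clinear_op_def)
    (metis blinfun_apply_blinfun_compose)

lemma positive_op_add: "positive_op S \<Longrightarrow> positive_op T \<Longrightarrow> positive_op (S + T)"
  by (auto intro!: positive_opI selfadjoint_op_add dest: positive_op_imp_selfadjoint
      simp: plus_blinfun.rep_eq inner_add_right positive_op_inner)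

lemma positive_op_scaleR: "positive_op T \<Longrightarrow> 0 \<le> r \<Longrightarrow> positive_op (r *\<^sub>R T)"
  by (auto intro!: positive_opI selfadjoint_op_scaleR dest: positive_op_imp_selfadjoint
      simp: scaleR_blinfun.rep_eq positive_op_inner)

lemma positive_op_square: "selfadjoint_op T \<Longrightarrow> positive_op (T o\<^sub>L T)"
  by (rule positive_opI) (auto intro: selfadjoint_op_compose_commuting
      simp: selfadjoint_op_inner[of T _ "T _", symmetric])

text \<open>For small \<open>d\<close> the map sending \<open>x\<close> to
  \<open>x - d *\<^sub>R (V x - y)\<close> is a contraction, and its fixed point solves
  \<open>V x = y\<close>. Coercivity also bounds \<open>V\<close> from below, which gives
  injectivity and the norm of the inverse.\<close>

lemma Lax_Milgram:
  fixes V :: "'a::{real_inner,complete_space} \<Rightarrow>\<^sub>L 'a"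
  assumes m: "m > 0" and coercive: "\<And>x. m * (norm x)\<^sup>2 \<le> inner x (V x)"
  shows "\<exists>S :: 'a \<Rightarrow>\<^sub>L 'a. \<forall>x. S (V x) = x \<and> V (S x) = x"
proof -
  have lower: "m * norm x \<le> norm (V x)" for x
  proof (cases "x = 0")
    case False
    have "m * norm x * norm x \<le> norm (V x) * norm x"
      using coercive[of x] norm_cauchy_schwarz[of x "V x"]
      by (simp add: power2_eq_square mult_ac)
    then show ?thesis using False by simp
  qed auto
  have inj: "x = y" if "V x = V y" for x y
    using lower[of "x - y"] m that by (simp add: blinfun.diff_right mult_le_0_iff)
  \<comment> \<open>The contraction factor squared is at most
    \<open>1 - 2 * d * m + d\<^sup>2 * L\<^sup>2\<close>, which is smallest at
    \<open>d = m / L\<^sup>2\<close> with value \<open>1 - m\<^sup>2 / L\<^sup>2\<close>. Adding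
    \<open>m\<close> to the norm ensures \<open>m \<le> L\<close>, so that this value is nonnegative
    and its root can be taken.\<close>
  define L where "L = norm V + m"
  have L: "L > 0" "norm V \<le> L" "m \<le> L" using m by (auto simp: L_def add_nonneg_pos)
  define d where "d = m / L\<^sup>2"
  have d: "d > 0" using m L by (simp add: d_def)
  define c where "c = sqrt (1 - m\<^sup>2 / L\<^sup>2)"
  have c: "0 \<le> c" "c < 1" "c\<^sup>2 = 1 - m\<^sup>2 / L\<^sup>2"
    using m L by (auto simp: c_def divide_le_eq power_mono)
  have contr: "norm (x - d *\<^sub>R V x) \<le> c * norm x" for x
  proof -
    have "(norm (x - d *\<^sub>R V x))\<^sup>2 = (norm x)\<^sup>2 - 2 * d * inner x (V x) + d\<^sup>2 * (norm (V x))\<^sup>2"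
      by (simp add: power2_norm_eq_inner inner_diff_left inner_diff_right inner_commute
          power2_eq_square[of d])
    also have "\<dots> \<le> (norm x)\<^sup>2 - 2 * d * (m * (norm x)\<^sup>2) + d\<^sup>2 * (L * norm x)\<^sup>2"
    proof -
      have "norm (V x) \<le> L * norm x"
        using norm_blinfun[of V x] L by (meson mult_right_mono norm_ge_zero order_trans)
      then have "d\<^sup>2 * (norm (V x))\<^sup>2 \<le> d\<^sup>2 * (L * norm x)\<^sup>2"
        by (intro mult_left_mono power_mono) auto
      moreover have "2 * d * (m * (norm x)\<^sup>2) \<le> 2 * d * inner x (V x)"
        using d coercive[of x] by (intro mult_left_mono) auto
      ultimately show ?thesis by linarith
    qed
    also have "\<dots> = (c * norm x)\<^sup>2"
      using L unfolding power_mult_distrib c d_def by (simp add: field_simps power2_eq_square)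
    finally show ?thesis
      using c by (simp add: abs_le_square_iff[symmetric])
  qed
  have surj: "\<exists>x. V x = y" for y
  proof -
    have "dist (x - d *\<^sub>R (V x - y)) (z - d *\<^sub>R (V z - y)) \<le> c * dist x z" for x z
      using contr[of "x - z"] by (simp add: dist_norm blinfun.diff_right algebra_simps)
    then obtain x where "x - d *\<^sub>R (V x - y) = x"
      using banach_fix_type[OF c(1,2), of "\<lambda>x. x - d *\<^sub>R (V x - y)"] by blast
    then show ?thesis using d by auto
  qed
  define g where "g y = (SOME x. V x = y)" for y
  have g: "V (g y) = y" for y
    unfolding g_def using surj by (rule someI_ex)
  have g': "g (V x) = x" for x
    using g inj by blast
  have "bounded_linear g"
  proof (rule bounded_linear_intro[where K = "1 / m"])
    show "g (x + y) = g x + g y" for x y by (metis blinfun.add_right g g')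
    show "g (r *\<^sub>R x) = r *\<^sub>R g x" for r x by (metis blinfun.scaleR_right g g')
    show "norm (g x) \<le> norm x * (1 / m)" for x
      using lower[of "g x"] m by (simp add: g field_simps)
  qed
  then show ?thesis
    by (intro exI[of _ "Blinfun g"]) (simp add: bounded_linear_Blinfun_apply g g')
qed

text \<open>The factor \<open>c\<close> turns the numerical range of \<open>T - z\<close> into the
  right half plane; the inverse of \<open>c (T - z)\<close> followed by this rotation is the
  resolvent.\<close>

lemma resolvent_if_coercive:
  fixes T :: "'a::complex_hilbert_space \<Rightarrow>\<^sub>L 'a"
  assumes m: "m > 0" and coercive: "\<And>x. m * (norm x)\<^sup>2 \<le> inner x (c *\<^sub>C (T x - z *\<^sub>C x))"
  shows "z \<notin> op_spectrum T"
proof -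
  define V where "V = Blinfun (\<lambda>x. c *\<^sub>C (T x - z *\<^sub>C x))"
  have "bounded_linear (\<lambda>x. c *\<^sub>C (T x - z *\<^sub>C x))"
    by (intro bounded_linear_compose[OF bounded_linear_scaleC]
        bounded_linear_sub bounded_linear_scaleC blinfun.bounded_linear_right)
  then have V: "V x = c *\<^sub>C (T x - z *\<^sub>C x)" for x
    by (simp add: V_def bounded_linear_Blinfun_apply)
  obtain S :: "'a \<Rightarrow>\<^sub>L 'a" where S: "S (V x) = x" "V (S x) = x" for x
    using Lax_Milgram[of m V] m coercive V by auto
  show ?thesis
  proof (cases "c = 0")
    case True \<comment> \<open>possible only on the zero space\<close>
    then have "x = 0" for x :: 'a
      using S(1)[of x] by (simp add: V blinfun.zero_right)
    then have "\<forall>x. S (T x - z *\<^sub>C x) = x \<and> T (S x) - z *\<^sub>C S x = x" by metis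
    then show ?thesis by (auto simp: op_spectrum_def)
  next
    case False
    define S' where "S' = Blinfun (\<lambda>x. S (c *\<^sub>C x))"
    have "bounded_linear (\<lambda>x. S (c *\<^sub>C x))"
      by (intro bounded_linear_compose[OF blinfun.bounded_linear_right] bounded_linear_scaleC)
    then have S': "S' x = S (c *\<^sub>C x)" for x
      by (simp add: S'_def bounded_linear_Blinfun_apply)
    have "T (S' x) - z *\<^sub>C S' x = x" for x
    proof -
      have "c *\<^sub>C (T (S' x) - z *\<^sub>C S' x) = c *\<^sub>C x"
        unfolding S' using S(2)[of "c *\<^sub>C x"] V by simp
      then have "inverse c *\<^sub>C c *\<^sub>C (T (S' x) - z *\<^sub>C S' x) = inverse c *\<^sub>C c *\<^sub>C x" by simp
      then show ?thesis using False by (simp add: scaleC_scaleC)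
    qed
    moreover have "S' (T x - z *\<^sub>C x) = x" for x
      using S(1)[of x] by (simp add: V S')
    ultimately show ?thesis by (auto simp: op_spectrum_def)
  qed
qed

lemma op_spectrum_positive:
  fixes T :: "'a::complex_hilbert_space \<Rightarrow>\<^sub>L 'a"
  assumes T: "positive_op T" and z: "z \<in> op_spectrum T"
  shows "\<exists>r\<in>{0..norm T}. z = complex_of_real r"
proof -
  \<comment> \<open>All three exclusions below are read off from this identity:
    \<open>c = \<i> * sgn (Im z)\<close> removes the form of \<open>T\<close> and leaves |Im z|,
    \<open>c = 1\<close> excludes negative real parts, and \<open>c = -1\<close> excludes real parts
    above the norm.\<close>
  have form: "inner x (c *\<^sub>C (T x - z *\<^sub>C x)) = Re c * inner x (T x) - Re (c * z) * (norm x)\<^sup>2" for c x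
    using selfadjoint_op_cinner_self[OF positive_op_imp_selfadjoint[OF T], of x]
    by (simp add: inner_eq_Re_cinner[of x "c *\<^sub>C (T x - z *\<^sub>C x)"] cinner_scaleC_right
        cinner_diff_right cinner_self algebra_simps flip: of_real_power)
  have pos: "0 \<le> inner x (T x)" for x by (rule positive_op_inner[OF T])
  have bound: "inner x (T x) \<le> norm T * (norm x)\<^sup>2" for x
  proof -
    have "inner x (T x) \<le> norm x * norm (T x)" by (rule norm_cauchy_schwarz)
    also have "\<dots> \<le> norm x * (norm T * norm x)"
      by (intro mult_left_mono norm_blinfun) auto
    finally show ?thesis by (simp add: power2_eq_square mult_ac)
  qed
  have "Im z = 0"
  proof (rule ccontr)
    assume "Im z \<noteq> 0"
    then have "\<bar>Im z\<bar> * (norm x)\<^sup>2 \<le> inner x ((\<i> * sgn (Im z)) *\<^sub>C (T x - z *\<^sub>C x))" for x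
      unfolding form by (auto simp: abs_sgn mult_ac)
    with z \<open>Im z \<noteq> 0\<close> show False using resolvent_if_coercive by (metis zero_less_abs_iff)
  qed
  moreover have "0 \<le> Re z"
  proof (rule ccontr)
    assume "\<not> 0 \<le> Re z"
    then have "(- Re z) * (norm x)\<^sup>2 \<le> inner x (1 *\<^sub>C (T x - z *\<^sub>C x))" for x
      unfolding form using pos[of x] by simp
    with z \<open>\<not> 0 \<le> Re z\<close> show False using resolvent_if_coercive[of "- Re z" 1 T z] by auto
  qed
  moreover have "Re z \<le> norm T"
  proof (rule ccontr)
    assume "\<not> Re z \<le> norm T"
    have "(Re z - norm T) * (norm x)\<^sup>2 \<le> inner x ((-1) *\<^sub>C (T x - z *\<^sub>C x))" for x
      unfolding form using bound[of x] by (simp add: algebra_simps)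
    with z \<open>\<not> Re z \<le> norm T\<close> show False
      using resolvent_if_coercive[of "Re z - norm T" "-1" T z] by auto
  qed
  ultimately show ?thesis by (intro bexI[of _ "Re z"]) (auto simp: complex_eq_iff)
qed

section \<open>Polynomials of an operator and the spectrum\<close>

interpretation blinfun_compose: bounded_bilinear "(o\<^sub>L)"
  by (rule bounded_bilinear_blinfun_compose)

lemma blinfun_compose_id [simp]: "T o\<^sub>L id_blinfun = T" "id_blinfun o\<^sub>L T = T"
  by (auto intro: blinfun_eqI)

lemma blinfun_compose_assoc: "(R o\<^sub>L S) o\<^sub>L T = R o\<^sub>L (S o\<^sub>L T)"
  by (auto intro: blinfun_eqI)

lemma op_power_0 [simp]: "op_power T 0 = id_blinfun"
  by (simp add: op_power_def)

lemma op_power_Suc: "op_power T (Suc n) = T o\<^sub>L op_power T n"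
  by (simp add: op_power_def)

lemma op_power_2: "op_power T 2 = T o\<^sub>L T"
  by (simp add: numeral_2_eq_2 op_power_Suc)

lemma op_poly_altdef:
  assumes "degree q \<le> n"
  shows "op_poly q T = (\<Sum>i\<le>n. coeff q i *\<^sub>R op_power T i)"
  unfolding op_poly_def
  using assms by (intro sum.mono_neutral_left) (auto simp: not_le coeff_eq_0)

lemma op_poly_0 [simp]: "op_poly 0 T = 0"
  by (simp add: op_poly_def)

lemma op_poly_pCons: "op_poly (pCons a q) T = a *\<^sub>R id_blinfun + (T o\<^sub>L op_poly q T)"
proof -
  have "op_poly (pCons a q) T = (\<Sum>i\<le>Suc (degree q). coeff (pCons a q) i *\<^sub>R op_power T i)"
    by (rule op_poly_altdef) (simp add: degree_pCons_le)
  also have "\<dots> = a *\<^sub>R id_blinfun + (\<Sum>i\<le>degree q. coeff q i *\<^sub>R op_power T (Suc i))"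
    by (subst sum.atMost_Suc_shift) simp
  also have "(\<Sum>i\<le>degree q. coeff q i *\<^sub>R op_power T (Suc i)) = T o\<^sub>L op_poly q T"
    by (simp add: op_poly_def blinfun_compose.sum_right blinfun_compose.scaleR_right op_power_Suc)
  finally show ?thesis .
qed

lemma op_poly_add: "op_poly (p + q) T = op_poly p T + op_poly q T"
  by (induction p q rule: poly_induct2)
     (simp_all add: op_poly_pCons blinfun_compose.add_right algebra_simps)

lemma op_poly_smult: "op_poly (smult a q) T = a *\<^sub>R op_poly q T"
  by (induction q) (simp_all add: op_poly_pCons blinfun_compose.scaleR_right scaleR_add_right)

lemma op_poly_diff: "op_poly (p - q) T = op_poly p T - op_poly q T"
  using op_poly_add[of p "smult (-1) q" T] unfolding op_poly_smult by simp

lemma op_poly_mult: "op_poly (p * q) T = op_poly p T o\<^sub>L op_poly q T"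
  by (induction p)
     (simp_all add: op_poly_pCons op_poly_add op_poly_smult blinfun_compose.add_left
       blinfun_compose.scaleR_left blinfun_compose_assoc)

lemma op_poly_commute: "op_poly p T o\<^sub>L op_poly q T = op_poly q T o\<^sub>L op_poly p T"
  by (metis mult.commute op_poly_mult)

lemma op_poly_monom_1 [simp]: "op_poly [:0, 1:] T = T"
  by (simp add: op_poly_pCons)

lemma selfadjoint_op_zero: "selfadjoint_op 0"
  by (simp add: selfadjoint_op_def clinear_op_def)

lemma selfadjoint_op_poly: "selfadjoint_op T \<Longrightarrow> selfadjoint_op (op_poly q T)"
proof (induction q)
  case (pCons a q)
  have "T o\<^sub>L op_poly q T = op_poly q T o\<^sub>L T"
    using op_poly_commute[of "[:0, 1:]" T q] by simp
  with pCons show ?case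
    by (auto simp: op_poly_pCons intro!: selfadjoint_op_add selfadjoint_op_scaleR
        selfadjoint_op_id selfadjoint_op_compose_commuting)
qed (simp add: selfadjoint_op_zero)

text \<open>Bounded operators form only a real vector space here, so a polynomial with complex
  coefficients acts on vectors directly, by Horner's scheme. Complex coefficients are what makes a
  factorization into linear factors available.\<close>

definition cpoly_apply ::
    "('a::complex_hilbert_space \<Rightarrow>\<^sub>L 'a) \<Rightarrow> complex poly \<Rightarrow> 'a \<Rightarrow> 'a" where
  "cpoly_apply T P x = fold_coeffs (\<lambda>a v. a *\<^sub>C x + T v) P 0"

lemma cpoly_apply_0 [simp]: "cpoly_apply T 0 x = 0"
  by (simp add: cpoly_apply_def)

lemma cpoly_apply_pCons: "cpoly_apply T (pCons a P) x = a *\<^sub>C x + T (cpoly_apply T P x)"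
proof (cases "a = 0 \<and> P = 0")
  case True
  then show ?thesis by (auto simp: cpoly_apply_def blinfun.zero_right)
next
  case False
  then show ?thesis
    by (cases "P = 0") (auto simp: cpoly_apply_def)
qed

lemma cpoly_apply_add: "cpoly_apply T (P + Q) x = cpoly_apply T P x + cpoly_apply T Q x"
  by (induction P Q rule: poly_induct2)
     (simp_all add: cpoly_apply_pCons scaleC_add_left blinfun.add_right)

lemma cpoly_apply_smult:
  "selfadjoint_op T \<Longrightarrow> cpoly_apply T (smult a P) x = a *\<^sub>C cpoly_apply T P x"
  by (induction P)
     (simp_all add: cpoly_apply_pCons scaleC_add_right scaleC_scaleC selfadjoint_op_scaleC)

lemma cpoly_apply_linear_factor:
  "selfadjoint_op T \<Longrightarrow>
    cpoly_apply T ([:- a, 1:] * P) x = T (cpoly_apply T P x) - a *\<^sub>C cpoly_apply T P x"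
proof -
  assume T: "selfadjoint_op T"
  have "cpoly_apply T ([:- a, 1:] * P) x = cpoly_apply T (smult (- a) P + pCons 0 P) x" by simp
  also have "\<dots> = T (cpoly_apply T P x) - a *\<^sub>C cpoly_apply T P x"
    unfolding cpoly_apply_add cpoly_apply_smult[OF T]
    by (simp add: cpoly_apply_pCons scaleC_minus_left)
  finally show ?thesis .
qed

lemma cpoly_apply_of_real: "cpoly_apply T (map_poly of_real q) x = op_poly q T x"
  by (induction q)
     (simp_all add: cpoly_apply_pCons op_poly_pCons map_poly_pCons plus_blinfun.rep_eq
       scaleR_blinfun.rep_eq scaleR_eq_scaleC)

lemma bounded_below_if_not_in_spectrum:
  fixes T :: "'a::complex_hilbert_space \<Rightarrow>\<^sub>L 'a"
  assumes "z \<notin> op_spectrum T"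
  shows "\<exists>d>0. \<forall>x. d * norm x \<le> norm (T x - z *\<^sub>C x)"
proof -
  obtain S :: "'a \<Rightarrow>\<^sub>L 'a" where S: "S (T x - z *\<^sub>C x) = x" for x
    using assms by (auto simp: op_spectrum_def)
  have "inverse (norm S + 1) * norm x \<le> norm (T x - z *\<^sub>C x)" for x
  proof -
    have "norm x \<le> norm S * norm (T x - z *\<^sub>C x)"
      using norm_blinfun[of S "T x - z *\<^sub>C x"] S by simp
    also have "\<dots> \<le> (norm S + 1) * norm (T x - z *\<^sub>C x)"
      by (intro mult_right_mono) auto
    finally show ?thesis
      using norm_ge_zero[of S]
      by (simp add: inverse_eq_divide pos_divide_le_eq add_nonneg_pos mult.commute)
  qed
  then show ?thesis
    by (intro exI[of _ "inverse (norm S + 1)"]) (auto simp: add_nonneg_pos)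
qed

text \<open>Peel off one complex root at a time: a factor \<open>T - a\<close> with \<open>a\<close>
  outside the spectrum is bounded below, and lower bounds multiply.\<close>

lemma cpoly_apply_bounded_below:
  fixes T :: "'a::complex_hilbert_space \<Rightarrow>\<^sub>L 'a"
  assumes "selfadjoint_op T" "P \<noteq> 0" "\<And>z. poly P z = 0 \<Longrightarrow> z \<notin> op_spectrum T"
  shows "\<exists>d>0. \<forall>x. d * norm x \<le> norm (cpoly_apply T P x)"
  using assms(2,3)
proof (induction "degree P" arbitrary: P)
  case 0
  then obtain a where "P = [:a:]" "a \<noteq> 0"
    by (metis degree_eq_zeroE pCons_eq_0_iff)
  then show ?case
    by (intro exI[of _ "cmod a"]) (auto simp: cpoly_apply_pCons norm_scaleC blinfun.zero_right)
next
  case (Suc n)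
  then obtain a where a: "poly P a = 0"
    using fundamental_theorem_of_algebra[of P] by (auto simp: constant_degree)
  then obtain Q where Q: "P = [:- a, 1:] * Q"
    by (auto simp: poly_eq_0_iff_dvd)
  with Suc.prems have "Q \<noteq> 0" by auto
  then have "degree P = 1 + degree Q"
    unfolding Q by (subst degree_mult_eq) auto
  with Suc.hyps(2) have "n = degree Q" by simp
  then obtain d where d: "d > 0" "d * norm x \<le> norm (cpoly_apply T Q x)" for x
    using Suc.hyps(1)[of Q] \<open>Q \<noteq> 0\<close> Suc.prems(2) by (auto simp: Q)
  obtain d' where d': "d' > 0" "d' * norm x \<le> norm (T x - a *\<^sub>C x)" for x
    using bounded_below_if_not_in_spectrum[of a T] Suc.prems(2) a by blast
  have "d' * d * norm x \<le> norm (cpoly_apply T P x)" for x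
  proof -
    have "d' * d * norm x \<le> d' * norm (cpoly_apply T Q x)"
      using d d' by (simp add: mult.assoc)
    also have "\<dots> \<le> norm (cpoly_apply T P x)"
      unfolding Q cpoly_apply_linear_factor[OF assms(1)] by (rule d')
    finally show ?thesis .
  qed
  with d d' show ?case by (intro exI[of _ "d' * d"]) auto
qed

text \<open>Let N be the norm of \<open>Q\<close>. If Q^2 - N^2 had the lower bound
  \<open>d\<close>, expanding the square of its norm at \<open>x\<close> would give \<open>(norm (Q
  x))\<^sup>2 \<le> (N\<^sup>2 - d\<^sup>2 / N\<^sup>2) * (norm x)\<^sup>2\<close>, so the norm of
  \<open>Q\<close> would be smaller than N. The nonzero vector \<open>x0\<close> serves to rule out
  \<open>N = 0\<close>.\<close>

lemma not_bounded_below_at_norm: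
  fixes Q :: "'a::complex_hilbert_space \<Rightarrow>\<^sub>L 'a"
  assumes Q: "selfadjoint_op Q" and "x0 \<noteq> (0::'a)" and d: "d > 0"
  shows "\<exists>x. norm (Q (Q x) - (norm Q)\<^sup>2 *\<^sub>R x) < d * norm x"
proof (rule ccontr)
  assume "\<not> ?thesis"
  then have lower: "d * norm x \<le> norm (Q (Q x) - (norm Q)\<^sup>2 *\<^sub>R x)" for x
    by (simp add: not_less)
  define N where "N = norm Q"
  have key: "d\<^sup>2 * (norm x)\<^sup>2 + N\<^sup>2 * (norm (Q x))\<^sup>2 \<le> N^4 * (norm x)\<^sup>2" for x
  proof -
    have "(d * norm x)\<^sup>2 \<le> (norm (Q (Q x) - N\<^sup>2 *\<^sub>R x))\<^sup>2"
      using lower[of x] d by (intro power_mono) (auto simp: N_def)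
    also have "\<dots> = (norm (Q (Q x)))\<^sup>2 - 2 * N\<^sup>2 * inner (Q (Q x)) x + N^4 * (norm x)\<^sup>2"
      unfolding power2_norm_eq_inner
      by (simp add: inner_diff_left inner_diff_right inner_commute power4_eq_xxxx power2_eq_square)
    also have "inner (Q (Q x)) x = (norm (Q x))\<^sup>2"
      by (simp add: selfadjoint_op_inner[OF Q, of "Q x"] power2_norm_eq_inner)
    also have "(norm (Q (Q x)))\<^sup>2 \<le> (N * norm (Q x))\<^sup>2"
      unfolding N_def by (intro power_mono norm_blinfun) auto
    finally show ?thesis by (simp add: power_mult_distrib)
  qed
  have N: "N > 0"
  proof (rule ccontr)
    assume "\<not> N > 0"
    then have "N = 0" by (simp add: N_def)
    with key[of x0] d assms(2) show False by (simp add: mult_le_0_iff)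
  qed
  define M where "M = N\<^sup>2 - d\<^sup>2 / N\<^sup>2"
  have bound: "(norm (Q x))\<^sup>2 \<le> M * (norm x)\<^sup>2" for x
  proof -
    have "N\<^sup>2 * (norm (Q x))\<^sup>2 \<le> N\<^sup>2 * (M * (norm x)\<^sup>2)"
      using key[of x] N by (simp add: M_def algebra_simps power4_eq_xxxx power2_eq_square)
    then show ?thesis using N by simp
  qed
  have M: "0 \<le> M"
    using order_trans[OF zero_le_power2 bound[of x0]] assms(2) by (simp add: zero_le_mult_iff)
  have "norm Q \<le> sqrt M"
  proof (rule norm_blinfun_bound)
    show "norm (Q x) \<le> sqrt M * norm x" for x
      using real_sqrt_le_mono[OF bound[of x]] by (simp add: real_sqrt_mult)
  qed (use M in auto)
  then have "N\<^sup>2 \<le> M"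
    using M N by (simp add: N_def real_le_rsqrt real_sqrt_le_iff sqrt_le_D flip: N_def)
      (metis N_def norm_ge_zero power_mono real_sqrt_pow2)
  moreover have "0 < d\<^sup>2 / N\<^sup>2" using N d by simp
  ultimately show False by (simp add: M_def)
qed

lemma poly_map_poly_of_real:
  "poly (map_poly complex_of_real q) (complex_of_real r) = complex_of_real (poly q r)"
  by (induction q) (simp_all add: map_poly_pCons)

lemma map_poly_of_real_eq_0_iff: "map_poly complex_of_real q = 0 \<longleftrightarrow> q = 0"
  by (subst map_poly_eq_0_iff) auto

text \<open>With \<open>N = \<parallel>q(T)\<parallel>\<close>, the operator \<open>q(T)\<^sup>2 - N\<^sup>2\<close> is not bounded below; factoring
  \<open>q\<^sup>2 - N\<^sup>2\<close> over the complex numbers, some linear factor \<open>T - z\<close> is not bounded below either.\<close>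

lemma op_spectrum_root_at_norm:
  fixes T :: "'a::complex_hilbert_space \<Rightarrow>\<^sub>L 'a"
  assumes T: "positive_op T" and "x0 \<noteq> (0::'a)" and ne: "q * q \<noteq> [:(norm (op_poly q T))\<^sup>2:]"
  shows "\<exists>r. complex_of_real r \<in> op_spectrum T \<and> (poly q r)\<^sup>2 = (norm (op_poly q T))\<^sup>2"
proof (rule ccontr)
  assume no: "\<not> ?thesis"
  note sa = positive_op_imp_selfadjoint[OF T]
  let ?N2 = "(norm (op_poly q T))\<^sup>2"
  define P where "P = map_poly complex_of_real (q * q - [:?N2:])"
  \<comment> \<open>A root of \<open>P\<close> in the spectrum would be real, and at a real root the
    square of \<open>q\<close> equals \<open>?N2\<close>, which \<open>no\<close> forbids.\<close>
  have "z \<notin> op_spectrum T" if "poly P z = 0" for z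
  proof
    assume z: "z \<in> op_spectrum T"
    then obtain r where r: "z = complex_of_real r" using op_spectrum_positive[OF T] by blast
    with that have "poly q r * poly q r = ?N2"
      by (simp only: P_def poly_map_poly_of_real of_real_eq_0_iff) simp
    with no z r show False by (auto simp: power2_eq_square)
  qed
  moreover have "P \<noteq> 0"
    using ne by (simp add: P_def map_poly_of_real_eq_0_iff)
  ultimately obtain d where d: "d > 0" "d * norm x \<le> norm (cpoly_apply T P x)" for x
    using cpoly_apply_bounded_below[OF sa, of P] by blast
  have "cpoly_apply T P x = op_poly q T (op_poly q T x) - ?N2 *\<^sub>R x" for x
    unfolding P_def cpoly_apply_of_real op_poly_diff op_poly_mult
    by (simp add: op_poly_pCons minus_blinfun.rep_eq scaleR_blinfun.rep_eq)
  with d not_bounded_below_at_norm[OF selfadjoint_op_poly[OF sa, of q] assms(2) d(1)]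
  show False by (metis not_le)
qed

text \<open>The norm of \<open>q(T)\<close> is attained as a value of |q| on the spectrum. The zero
  space is treated apart because its operators have empty spectrum. If \<open>q * q\<close> is the
  constant \<open>?N2\<close>, the factorization argument says nothing about \<open>q\<close>
  itself; it is then applied to the polynomial \<open>[:0, 1:]\<close>, merely to produce a point of
  the spectrum.\<close>

lemma norm_op_poly_le:
  fixes T :: "'a::complex_hilbert_space \<Rightarrow>\<^sub>L 'a"
  assumes T: "positive_op T" and c: "0 \<le> c"
    and le: "\<And>r. complex_of_real r \<in> op_spectrum T \<Longrightarrow> \<bar>poly q r\<bar> \<le> c"
  shows "norm (op_poly q T) \<le> c"
proof (cases "\<exists>x0::'a. x0 \<noteq> 0")
  case False
  then show ?thesis
    using c by (intro norm_blinfun_bound) (metis norm_zero mult_nonneg_nonneg norm_ge_zero)+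
next
  case True
  then obtain x0 :: 'a where x0: "x0 \<noteq> 0" by blast
  let ?N2 = "(norm (op_poly q T))\<^sup>2"
  have "\<exists>r. complex_of_real r \<in> op_spectrum T \<and> (poly q r)\<^sup>2 = ?N2"
  proof (cases "q * q = [:?N2:]")
    case False
    then show ?thesis by (rule op_spectrum_root_at_norm[OF T x0])
  next
    case eq: True \<comment> \<open>\<open>q\<close> is constant, so any point of the spectrum will do\<close>
    obtain r where "complex_of_real r \<in> op_spectrum T"
      using op_spectrum_root_at_norm[OF T x0, of "[:0, 1:]"] by auto
    moreover have "(poly q r)\<^sup>2 = ?N2"
      using arg_cong[OF eq, of "\<lambda>p. poly p r"] by (simp add: power2_eq_square)
    ultimately show ?thesis by blast
  qed
  then obtain r where r: "complex_of_real r \<in> op_spectrum T" "(poly q r)\<^sup>2 = ?N2" by blast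
  then have "\<bar>poly q r\<bar> = norm (op_poly q T)"
    by (metis abs_norm_cancel power2_eq_iff abs_minus_cancel)
  with le[OF r(1)] show ?thesis by simp
qed

section \<open>Continuous functional calculus of positive operators\<close>

lemma uniform_limit_real_poly:
  fixes f :: "real \<Rightarrow> real"
  assumes "compact S" "continuous_on S f"
  obtains q :: "nat \<Rightarrow> real poly" where "uniform_limit S (\<lambda>n. poly (q n)) f sequentially"
proof -
  obtain g where g: "uniform_limit S g f sequentially" "\<And>n. polynomial_function (g n)"
    using Stone_Weierstrass_uniform_limit[OF assms] by blast
  have "\<exists>q. g n = poly q" for n
  proof -
    obtain a m where "g n = (\<lambda>x. \<Sum>i\<le>m. a i * x ^ i)"
      using g(2)[of n] unfolding real_polynomial_function_eq[symmetric]
        real_polynomial_function_iff_sum by blast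
    then have "g n = poly (\<Sum>i\<le>m. monom (a i) i)"
      by (auto simp: poly_sum poly_monom)
    then show ?thesis by blast
  qed
  then obtain q where "\<And>n. g n = poly (q n)" by metis
  with g(1) have "uniform_limit S (\<lambda>n. poly (q n)) f sequentially"
    by (simp cong: uniform_limit_cong')
  then show ?thesis by (rule that)
qed

lemma op_spectrum_positive_of_real:
  "positive_op T \<Longrightarrow> complex_of_real r \<in> op_spectrum T \<Longrightarrow> r \<in> {0..norm T}"
  using op_spectrum_positive by fastforce

text \<open>Discharges the definite description in \<open>op_fun\<close>. Existence comes from one
  approximating sequence, which is Cauchy by the spectral bound; the same bound shows that every
  other approximating sequence has the same limit. Continuity is asked for on the whole half line so
  that one hypothesis serves all positive operators.\<close>

lemma op_fun_tendsto:
  assumes T: "positive_op T" and f: "continuous_on {0..} f"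
    and q: "uniform_limit {r. complex_of_real r \<in> op_spectrum T} (\<lambda>n. poly (q n)) f sequentially"
  shows "(\<lambda>n. op_poly (q n) T) \<longlonglongrightarrow> op_fun f T"
proof -
  let ?S = "{r. complex_of_real r \<in> op_spectrum T}"
  have S: "?S \<subseteq> {0..norm T}"
    using op_spectrum_positive_of_real[OF T] by blast
  have "continuous_on {0..norm T} f"
    by (rule continuous_on_subset[OF f]) auto
  from uniform_limit_real_poly[OF compact_Icc this]
  obtain q0 where "uniform_limit {0..norm T} (\<lambda>n. poly (q0 n)) f sequentially" by blast
  then have q0: "uniform_limit ?S (\<lambda>n. poly (q0 n)) f sequentially"
    by (rule uniform_limit_on_subset) (rule S)
  \<comment> \<open>Used twice: with \<open>q1 = q2\<close> it gives the Cauchy property, with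
    different sequences the independence of the limit from the sequence.\<close>
  have close: "\<exists>N. \<forall>m\<ge>N. \<forall>n\<ge>N. norm (op_poly (q1 m) T - op_poly (q2 n) T) \<le> e"
    if q1: "uniform_limit ?S (\<lambda>n. poly (q1 n)) f sequentially"
      and q2: "uniform_limit ?S (\<lambda>n. poly (q2 n)) f sequentially" and "e > 0" for q1 q2 and e :: real
  proof -
    from \<open>e > 0\<close> have "e / 2 > 0" by simp
    from uniform_limitD[OF q1 this] uniform_limitD[OF q2 this]
    obtain N where N: "\<forall>n\<ge>N. \<forall>x\<in>?S. dist (poly (q1 n) x) (f x) < e / 2"
      "\<forall>n\<ge>N. \<forall>x\<in>?S. dist (poly (q2 n) x) (f x) < e / 2"
      unfolding eventually_sequentially by (metis (no_types, lifting) le_trans linear)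
    have "norm (op_poly (q1 m - q2 n) T) \<le> e" if "m \<ge> N" "n \<ge> N" for m n
    proof (rule norm_op_poly_le[OF T])
      fix r assume "complex_of_real r \<in> op_spectrum T"
      then have "dist (poly (q1 m) r) (f r) < e / 2" "dist (poly (q2 n) r) (f r) < e / 2"
        using N that by auto
      then show "\<bar>poly (q1 m - q2 n) r\<bar> \<le> e" unfolding dist_real_def poly_diff by linarith
    qed (use \<open>e > 0\<close> in auto)
    then show ?thesis by (auto simp: op_poly_diff)
  qed
  have "Cauchy (\<lambda>n. op_poly (q0 n) T)"
  proof (rule metric_CauchyI)
    fix e :: real assume "e > 0"
    then obtain N where N: "\<forall>m\<ge>N. \<forall>n\<ge>N. norm (op_poly (q0 m) T - op_poly (q0 n) T) \<le> e / 2"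
      using close[OF q0 q0, of "e / 2"] by auto
    have "dist (op_poly (q0 m) T) (op_poly (q0 n) T) < e" if "m \<ge> N" "n \<ge> N" for m n
    proof -
      have "dist (op_poly (q0 m) T) (op_poly (q0 n) T) \<le> e / 2"
        using N that by (simp add: dist_norm)
      with \<open>e > 0\<close> show ?thesis by linarith
    qed
    then show "\<exists>M. \<forall>m\<ge>M. \<forall>n\<ge>M. dist (op_poly (q0 m) T) (op_poly (q0 n) T) < e" by blast
  qed
  then obtain F where F: "(\<lambda>n. op_poly (q0 n) T) \<longlonglongrightarrow> F"
    using Cauchy_convergent convergent_def by blast
  have lim: "(\<lambda>n. op_poly (q1 n) T) \<longlonglongrightarrow> F"
    if q1: "uniform_limit ?S (\<lambda>n. poly (q1 n)) f sequentially" for q1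
  proof -
    have "(\<lambda>n. op_poly (q1 n) T - op_poly (q0 n) T) \<longlonglongrightarrow> 0"
    proof (rule LIMSEQ_I)
      fix e :: real assume "e > 0"
      then obtain N where "\<forall>m\<ge>N. \<forall>n\<ge>N. norm (op_poly (q1 m) T - op_poly (q0 n) T) \<le> e / 2"
        using close[OF q1 q0, of "e / 2"] by auto
      with \<open>e > 0\<close> show "\<exists>N. \<forall>n\<ge>N. norm (op_poly (q1 n) T - op_poly (q0 n) T - 0) < e"
        by (intro exI[of _ N]) fastforce
    qed
    from tendsto_add[OF this F] show ?thesis by simp
  qed
  have "op_fun f T = F"
    unfolding op_fun_def
  proof (rule the_equality)
    show "F' = F"
      if "\<forall>q. uniform_limit ?S (\<lambda>n. poly (q n)) f sequentially \<longrightarrow> (\<lambda>n. op_poly (q n) T) \<longlonglongrightarrow> F'" for F'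
      using that q0 F LIMSEQ_unique by blast
  qed (use lim in auto)
  with lim[OF q] show ?thesis by simp
qed

text \<open>The interval \<open>{0..norm T}\<close> stands in for the spectrum that it contains: its
  compactness is immediate, and approximation on it can be added, multiplied and composed without
  looking at the spectrum again.\<close>

lemma op_fun_approx:
  assumes T: "positive_op T" and f: "continuous_on {0..} f"
  obtains q where "uniform_limit {0..norm T} (\<lambda>n. poly (q n)) f sequentially"
    "(\<lambda>n. op_poly (q n) T) \<longlonglongrightarrow> op_fun f T"
proof -
  have "continuous_on {0..norm T} f"
    by (rule continuous_on_subset[OF f]) auto
  from uniform_limit_real_poly[OF compact_Icc this]
  obtain q where q: "uniform_limit {0..norm T} (\<lambda>n. poly (q n)) f sequentially" by blast
  have "(\<lambda>n. op_poly (q n) T) \<longlonglongrightarrow> op_fun f T"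
    by (intro op_fun_tendsto T f uniform_limit_on_subset[OF q])
       (use op_spectrum_positive_of_real[OF T] in blast)
  with q show ?thesis by (rule that)
qed

lemma op_fun_tendsto':
  assumes "positive_op T" "continuous_on {0..} f"
    and "uniform_limit {0..norm T} (\<lambda>n. poly (q n)) f sequentially"
  shows "(\<lambda>n. op_poly (q n) T) \<longlonglongrightarrow> op_fun f T"
  by (intro op_fun_tendsto assms uniform_limit_on_subset[OF assms(3)])
     (use op_spectrum_positive_of_real[OF assms(1)] in blast)

lemma op_fun_cong:
  assumes T: "positive_op T" and eq: "\<And>r. 0 \<le> r \<Longrightarrow> f r = g r"
  shows "op_fun f T = op_fun g T"
proof -
  have "uniform_limit {r. complex_of_real r \<in> op_spectrum T} h f sequentially \<longleftrightarrow>
      uniform_limit {r. complex_of_real r \<in> op_spectrum T} h g sequentially" for h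
    using op_spectrum_positive_of_real[OF T] eq by (intro uniform_limit_cong') auto
  then show ?thesis by (simp add: op_fun_def)
qed

lemma op_fun_poly: "positive_op T \<Longrightarrow> op_fun (poly q) T = op_poly q T"
  using op_fun_tendsto'[of T "poly q" "\<lambda>_. q"]
  by (simp add: uniform_limit_const LIMSEQ_const_iff continuous_intros)

lemma op_fun_const: "positive_op T \<Longrightarrow> op_fun (\<lambda>_. a) T = a *\<^sub>R id_blinfun"
  using op_fun_poly[of T "[:a:]"] by (simp add: op_poly_pCons poly_pCons[abs_def])

lemma op_fun_ident: "positive_op T \<Longrightarrow> op_fun (\<lambda>x. x) T = T"
proof -
  assume "positive_op T"
  moreover have "poly [:0, 1:] = (\<lambda>x::real. x)" by auto
  ultimately show ?thesis using op_fun_poly[of T "[:0, 1:]"] by simp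
qed

lemma op_fun_add:
  assumes T: "positive_op T" and f: "continuous_on {0..} f" and g: "continuous_on {0..} g"
  shows "op_fun (\<lambda>x. f x + g x) T = op_fun f T + op_fun g T"
proof -
  obtain p q where
    p: "uniform_limit {0..norm T} (\<lambda>n. poly (p n)) f sequentially"
      "(\<lambda>n. op_poly (p n) T) \<longlonglongrightarrow> op_fun f T" and
    q: "uniform_limit {0..norm T} (\<lambda>n. poly (q n)) g sequentially"
      "(\<lambda>n. op_poly (q n) T) \<longlonglongrightarrow> op_fun g T"
    using op_fun_approx T f g by metis
  have "(\<lambda>n. op_poly (p n + q n) T) \<longlonglongrightarrow> op_fun (\<lambda>x. f x + g x) T"
    using uniform_limit_add[OF p(1) q(1)]
    by (intro op_fun_tendsto' T continuous_intros f g) (simp add: poly_add[abs_def])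
  moreover have "(\<lambda>n. op_poly (p n + q n) T) \<longlonglongrightarrow> op_fun f T + op_fun g T"
    unfolding op_poly_add by (intro tendsto_add p q)
  ultimately show ?thesis by (rule LIMSEQ_unique)
qed

lemma op_fun_mult:
  assumes T: "positive_op T" and f: "continuous_on {0..} f" and g: "continuous_on {0..} g"
  shows "op_fun (\<lambda>x. f x * g x) T = op_fun f T o\<^sub>L op_fun g T"
proof -
  obtain p q where
    p: "uniform_limit {0..norm T} (\<lambda>n. poly (p n)) f sequentially"
      "(\<lambda>n. op_poly (p n) T) \<longlonglongrightarrow> op_fun f T" and
    q: "uniform_limit {0..norm T} (\<lambda>n. poly (q n)) g sequentially"
      "(\<lambda>n. op_poly (q n) T) \<longlonglongrightarrow> op_fun g T"
    using op_fun_approx T f g by metis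
  \<comment> \<open>A product of uniform limits is a uniform limit when the limit functions are
    bounded; compactness of the interval provides this.\<close>
  have "bounded (h ` {0..norm T})" if "continuous_on {0..} h" for h :: "real \<Rightarrow> real"
    by (intro compact_imp_bounded compact_continuous_image continuous_on_subset[OF that]) auto
  then have "uniform_limit {0..norm T} (\<lambda>n x. poly (p n) x * poly (q n) x)
      (\<lambda>x. f x * g x) sequentially"
    using f g by (intro uniform_lim_mult p q) auto
  then have "(\<lambda>n. op_poly (p n * q n) T) \<longlonglongrightarrow> op_fun (\<lambda>x. f x * g x) T"
    by (intro op_fun_tendsto' T continuous_intros f g) (simp add: poly_mult[abs_def])
  moreover have "(\<lambda>n. op_poly (p n * q n) T) \<longlonglongrightarrow> (op_fun f T o\<^sub>L op_fun g T)"
    unfolding op_poly_mult by (intro blinfun_compose.tendsto p q)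
  ultimately show ?thesis by (rule LIMSEQ_unique)
qed

lemma op_fun_cmult:
  assumes T: "positive_op T" and f: "continuous_on {0..} f"
  shows "op_fun (\<lambda>x. a * f x) T = a *\<^sub>R op_fun f T"
  using op_fun_mult[OF T _ f, of "\<lambda>_. a"]
  by (simp add: op_fun_const[OF T] blinfun_compose.scaleR_left continuous_intros)

lemma op_fun_diff:
  assumes T: "positive_op T" and f: "continuous_on {0..} f" and g: "continuous_on {0..} g"
  shows "op_fun (\<lambda>x. f x - g x) T = op_fun f T - op_fun g T"
proof -
  have "op_fun (\<lambda>x. f x + (-1) * g x) T = op_fun f T + (-1) *\<^sub>R op_fun g T"
    by (subst op_fun_add[OF T f], intro continuous_intros g) (simp only: op_fun_cmult[OF T g])
  then show ?thesis by simp
qed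

lemma op_fun_sum:
  assumes T: "positive_op T" and f: "\<And>i. i \<in> I \<Longrightarrow> continuous_on {0..} (f i)"
  shows "op_fun (\<lambda>x. \<Sum>i\<in>I. f i x) T = (\<Sum>i\<in>I. op_fun (f i) T)"
  using f
proof (induction I rule: infinite_finite_induct)
  case (insert i I)
  then show ?case
    by (simp add: op_fun_add[OF T] continuous_intros)
qed (simp_all add: op_fun_const[OF T])

lemma norm_op_fun_le:
  assumes T: "positive_op T" and f: "continuous_on {0..} f"
    and le: "\<And>r. 0 \<le> r \<Longrightarrow> r \<le> norm T \<Longrightarrow> \<bar>f r\<bar> \<le> c"
  shows "norm (op_fun f T) \<le> c"
proof (rule field_le_epsilon)
  fix e :: real assume "e > 0"
  obtain q where q: "uniform_limit {0..norm T} (\<lambda>n. poly (q n)) f sequentially"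
      "(\<lambda>n. op_poly (q n) T) \<longlonglongrightarrow> op_fun f T"
    using op_fun_approx[OF T f] by blast
  have c: "0 \<le> c" using le[of 0] by simp
  have "\<forall>\<^sub>F n in sequentially. norm (op_poly (q n) T) \<le> c + e"
    using uniform_limitD[OF q(1) \<open>e > 0\<close>]
  proof eventually_elim
    case (elim n)
    show ?case
    proof (rule norm_op_poly_le[OF T])
      fix r assume "complex_of_real r \<in> op_spectrum T"
      then have "r \<in> {0..norm T}" by (rule op_spectrum_positive_of_real[OF T])
      with elim le[of r] show "\<bar>poly (q n) r\<bar> \<le> c + e" by (force simp: dist_real_def)
    qed (use c \<open>e > 0\<close> in auto)
  qed
  then show "norm (op_fun f T) \<le> c + e"
    by (rule tendsto_upperbound[OF tendsto_norm[OF q(2)]]) simp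
qed

section \<open>Self-adjointness, positivity and composition in the calculus\<close>

lemma selfadjoint_op_LIMSEQ:
  assumes F: "F \<longlonglongrightarrow> G" and sa: "\<And>n. selfadjoint_op (F n)"
  shows "selfadjoint_op G"
proof -
  have lim: "(\<lambda>n. F n x) \<longlonglongrightarrow> G x" for x
    by (intro blinfun.tendsto F tendsto_const)
  have "G (c *\<^sub>C x) = c *\<^sub>C G x" for c x
    using lim[of "c *\<^sub>C x"] bounded_linear.tendsto[OF bounded_linear_scaleC lim, of c x]
    by (simp add: selfadjoint_op_scaleC[OF sa] LIMSEQ_unique)
  moreover have "cinner (G x) y = cinner x (G y)" for x y
    using bounded_linear.tendsto[OF bounded_linear_cinner_left[of y] lim[of x]]
      bounded_linear.tendsto[OF bounded_linear_cinner_right[of x] lim[of y]]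
    by (simp add: selfadjoint_opD[OF sa, of _ x y] LIMSEQ_unique)
  ultimately show ?thesis by (simp add: selfadjoint_op_def clinear_op_def)
qed

lemma selfadjoint_op_fun:
  assumes T: "positive_op T" and f: "continuous_on {0..} f"
  shows "selfadjoint_op (op_fun f T)"
proof -
  obtain q where "(\<lambda>n. op_poly (q n) T) \<longlonglongrightarrow> op_fun f T"
    using op_fun_approx[OF T f] by blast
  then show ?thesis
    by (rule selfadjoint_op_LIMSEQ)
       (intro selfadjoint_op_poly positive_op_imp_selfadjoint T)
qed

text \<open>\<open>f(T)\<close> is the square of the self-adjoint operator obtained from the square
  root of \<open>f\<close>.\<close>

lemma positive_op_fun:
  assumes T: "positive_op T" and f: "continuous_on {0..} f" and pos: "\<And>r. 0 \<le> r \<Longrightarrow> 0 \<le> f r"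
  shows "positive_op (op_fun f T)"
proof -
  have sqrt: "continuous_on {0..} (\<lambda>r. sqrt (f r))"
    by (intro continuous_intros f)
  have "op_fun f T = op_fun (\<lambda>r. sqrt (f r) * sqrt (f r)) T"
    using pos by (intro op_fun_cong T) simp
  then show ?thesis
    by (simp only: op_fun_mult[OF T sqrt sqrt])
       (intro positive_op_square selfadjoint_op_fun T sqrt)
qed

lemma op_poly_op_fun:
  assumes T: "positive_op T" and g: "continuous_on {0..} g"
  shows "op_poly q (op_fun g T) = op_fun (\<lambda>x. poly q (g x)) T"
proof (induction q)
  case (pCons a q)
  have "op_fun (\<lambda>x. a + g x * poly q (g x)) T =
      op_fun (\<lambda>_. a) T + op_fun (\<lambda>x. g x * poly q (g x)) T"
    by (intro op_fun_add T continuous_intros g)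
  also have "op_fun (\<lambda>x. g x * poly q (g x)) T = op_fun g T o\<^sub>L op_fun (\<lambda>x. poly q (g x)) T"
    by (intro op_fun_mult T continuous_intros g)
  finally show ?case
    by (simp add: op_poly_pCons pCons op_fun_const[OF T])
qed (simp add: op_fun_const[OF T])

text \<open>One sequence of polynomials approximates \<open>f\<close> on \<open>{0..R}\<close>,
  where \<open>R\<close> is large enough to cover both \<open>{0..norm S}\<close> and the values of
  \<open>g\<close> on \<open>{0..norm T}\<close>. Evaluated at \<open>S = g(T)\<close>, it converges
  to \<open>f(S)\<close> by the first inclusion and to the composite function of \<open>T\<close> by
  the second.\<close>

lemma op_fun_compose:
  assumes T: "positive_op T" and f: "continuous_on {0..} f" and g: "continuous_on {0..} g"
    and pos: "\<And>r. 0 \<le> r \<Longrightarrow> 0 \<le> g r"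
  shows "op_fun f (op_fun g T) = op_fun (\<lambda>x. f (g x)) T"
proof -
  define S where "S = op_fun g T"
  have S: "positive_op S" unfolding S_def by (rule positive_op_fun[OF T g pos])
  have "bounded (g ` {0..norm T})"
    by (intro compact_imp_bounded compact_continuous_image continuous_on_subset[OF g]) auto
  then obtain M where "\<forall>y\<in>g ` {0..norm T}. norm y \<le> M"
    unfolding bounded_iff by blast
  then have M: "\<bar>g x\<bar> \<le> M" if "x \<in> {0..norm T}" for x
    using that by auto
  define R where "R = max M (norm S)"
  have "continuous_on {0..R} f"
    by (rule continuous_on_subset[OF f]) auto
  from uniform_limit_real_poly[OF compact_Icc this]
  obtain q where q: "uniform_limit {0..R} (\<lambda>n. poly (q n)) f sequentially" by blast
  have fg: "continuous_on {0..} (\<lambda>x. f (g x))"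
    using pos by (intro continuous_on_compose2[OF f g]) auto
  have "(\<lambda>n. op_poly (q n) S) \<longlonglongrightarrow> op_fun f S"
    by (intro op_fun_tendsto' S f uniform_limit_on_subset[OF q]) (auto simp: R_def)
  moreover have "(\<lambda>n. op_poly (q n) S) \<longlonglongrightarrow> op_fun (\<lambda>x. f (g x)) T"
  proof (rule metric_LIMSEQ_I)
    fix e :: real assume "e > 0"
    then have "e / 2 > 0" by simp
    from uniform_limitD[OF q this]
    obtain N where N: "dist (poly (q n) x) (f x) < e / 2" if "n \<ge> N" "x \<in> {0..R}" for n x
      unfolding eventually_sequentially by blast
    have "dist (op_poly (q n) S) (op_fun (\<lambda>x. f (g x)) T) < e" if "n \<ge> N" for n
    proof -
      have "dist (op_poly (q n) S) (op_fun (\<lambda>x. f (g x)) T) =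
          norm (op_fun (\<lambda>x. poly (q n) (g x) - f (g x)) T)"
        unfolding S_def op_poly_op_fun[OF T g]
        by (subst op_fun_diff[OF T _ fg]) (auto intro!: continuous_intros g simp: dist_norm)
      also have "\<dots> \<le> e / 2"
      proof (rule norm_op_fun_le[OF T])
        fix r assume "0 \<le> r" "r \<le> norm T"
        then have "g r \<in> {0..R}" using M[of r] pos[of r] by (auto simp: R_def)
        then show "\<bar>poly (q n) (g r) - f (g r)\<bar> \<le> e / 2"
          using N[OF that] by (simp add: dist_real_def less_imp_le)
      qed (intro continuous_intros g fg)
      finally show ?thesis using \<open>e > 0\<close> by linarith
    qed
    then show "\<exists>no. \<forall>n\<ge>no. dist (op_poly (q n) S) (op_fun (\<lambda>x. f (g x)) T) < e" by blast
  qed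
  ultimately show ?thesis
    unfolding S_def by (rule LIMSEQ_unique)
qed

section \<open>Real powers and the absolute value\<close>

lemma continuous_on_powr_atLeast_0: "0 < s \<Longrightarrow> continuous_on {0..} (\<lambda>r::real. r powr s)"
  by (intro continuous_on_powr') (auto intro: continuous_intros)

lemma positive_op_powr: "positive_op T \<Longrightarrow> 0 < s \<Longrightarrow> positive_op (op_powr T s)"
  unfolding op_powr_def by (intro positive_op_fun continuous_on_powr_atLeast_0) auto

lemma op_powr_powr:
  assumes "positive_op T" "0 < s" "0 < s'"
  shows "op_powr (op_powr T s) s' = op_powr T (s * s')"
  unfolding op_powr_def
  by (subst op_fun_compose) (use assms in \<open>auto intro: continuous_on_powr_atLeast_0 simp: powr_powr\<close>)

lemma op_powr_add:
  assumes "positive_op T" "0 < s" "0 < s'"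
  shows "op_powr T s o\<^sub>L op_powr T s' = op_powr T (s + s')"
  unfolding op_powr_def powr_add
  by (rule op_fun_mult[symmetric]) (use assms in \<open>auto intro: continuous_on_powr_atLeast_0\<close>)

lemma op_powr_one:
  assumes "positive_op T"
  shows "op_powr T 1 = T"
  using op_fun_cong[OF assms, of "\<lambda>r. r powr 1" "\<lambda>r. r"] op_fun_ident[OF assms]
  by (simp add: op_powr_def)

text \<open>Lets the trace class hypothesis on a positive operator be read as summability of its own
  diagonal entries.\<close>

lemma op_abs_positive:
  assumes T: "positive_op T"
  shows "op_abs T = T"
proof -
  have "adjoint_op T = T"
    unfolding adjoint_op_def
  proof (rule the_equality)
    show "\<forall>x y. cinner (T x) y = cinner x (T y)"
      using positive_op_imp_selfadjoint[OF T] by (simp add: selfadjoint_op_def)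
  next
    fix S :: "'a \<Rightarrow>\<^sub>L 'a" assume S: "\<forall>x y. cinner (T x) y = cinner x (S y)"
    show "S = T"
    proof (rule blinfun_eqI)
      fix y
      have "cinner x (S y - T y) = 0" for x
        using S selfadjoint_opD[OF positive_op_imp_selfadjoint[OF T], of x y]
        by (simp add: cinner_diff_right)
      then have "cinner (S y - T y) (S y - T y) = 0" by blast
      then show "S y = T y" by (simp add: cinner_self)
    qed
  qed
  then have "op_abs T = op_fun sqrt (op_fun (\<lambda>x. x * x) T)"
    by (simp add: op_abs_def op_fun_mult[OF T] op_fun_ident[OF T] continuous_intros)
  also have "\<dots> = op_fun (\<lambda>x. sqrt (x * x)) T"
    by (intro op_fun_compose T continuous_intros) auto
  also have "\<dots> = op_fun (\<lambda>x. x) T"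
    by (intro op_fun_cong T) auto
  finally show ?thesis by (simp add: op_fun_ident[OF T])
qed

section \<open>Powers as limits of sums of resolvent functions\<close>

lemma summable_on_int_if_two_sided:
  fixes f :: "int \<Rightarrow> real"
  assumes "(\<lambda>n. f (int n)) summable_on UNIV" "(\<lambda>n. f (- int n)) summable_on UNIV"
  shows "f summable_on UNIV"
proof -
  have "f summable_on range int"
    using assms(1) by (subst summable_on_reindex) (auto simp: o_def)
  moreover have "f summable_on range (\<lambda>n. - int n)"
    using assms(2) by (subst summable_on_reindex) (auto simp: o_def inj_on_def)
  then have "f summable_on (- range int)"
  proof (rule summable_on_subset_banach)
    show "- range int \<subseteq> range (\<lambda>n. - int n)"
    proof
      fix k assume "k \<in> - range int"
      then show "k \<in> range (\<lambda>n. - int n)"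
        by (cases k rule: int_cases2) auto
    qed
  qed
  ultimately have "f summable_on (range int \<union> - range int)"
    by (rule summable_on_Un_disjoint) auto
  then show ?thesis by (simp add: Un_commute)
qed

text \<open>The coefficients are nonnegative, so that sign conditions valid for every x / (x + u)
  pass to the sums; the error is uniform on \<open>{0..R}\<close>, so that they also survive the
  limit.\<close>

lemma powr_approx_resolvent_sums:
  fixes s R e :: real
  assumes s: "0 < s" "s < 1" and R: "0 < R" and e: "0 < e"
  shows "\<exists>(F :: int set) c u. finite F \<and> (\<forall>k\<in>F. 0 \<le> c k \<and> 0 < u k) \<and>
    (\<forall>x\<in>{0..R}. \<bar>x powr s - (\<Sum>k\<in>F. c k * (x / (x + u k)))\<bar> \<le> e)"
proof -
  \<comment> \<open>Half of \<open>e\<close> is spent on replacing the power by the full series, the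
    other half on truncating the series. The ratio \<open>h\<close> is chosen so that
    \<open>h powr s = 1 + d\<close>, and \<open>d\<close> so that the first error, at most
    \<open>d * R powr s\<close>, is \<open>e / 2\<close>.\<close>
  define d where "d = e / (2 * R powr s)"
  have d: "d > 0" using R e by (simp add: d_def)
  define h where "h = (1 + d) powr (1 / s)"
  have h: "h > 1" "h powr s = 1 + d"
    using d s by (auto simp: h_def powr_powr intro: gr_one_powr)
  define v where "v k = h powr (real_of_int k)" for k
  have v: "v k > 0" for k using h by (simp add: v_def)
  define t where "t k x = v k powr s * (x / (x + v k))" for k x
  \<comment> \<open>A majorant valid for all \<open>x\<close> in \<open>{0..B}\<close> at once, from
    the two bounds 1 and \<open>B / v k\<close> on \<open>x / (x + v k)\<close>. Since
    \<open>0 < s < 1\<close>, the first makes it decay geometrically as \<open>k\<close> tends to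
    minus infinity, the second as \<open>k\<close> tends to plus infinity.\<close>
  define M where "M B k = min (v k powr s) (B * v k powr (s - 1))" for B k
  have t: "0 \<le> t k x" "t k x \<le> M B k" if "0 \<le> x" "x \<le> B" for k x B
  proof -
    show "0 \<le> t k x" using that v[of k] by (simp add: t_def)
    have "x / (x + v k) \<le> 1" using that v[of k] by (simp add: divide_le_eq_1)
    then have "t k x \<le> v k powr s * 1"
      unfolding t_def by (intro mult_left_mono) auto
    moreover have "x / (x + v k) \<le> B / v k"
      using that v[of k] by (intro frac_le) auto
    then have "t k x \<le> v k powr s * (B / v k)"
      unfolding t_def by (intro mult_left_mono) auto
    then have "t k x \<le> B * v k powr (s - 1)"
      using v[of k] by (simp add: powr_diff mult.commute)
    ultimately show "t k x \<le> M B k" by (simp add: M_def)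
  qed
  have M_summable: "M B summable_on UNIV" if B: "B \<ge> 0" for B
  proof (rule summable_on_int_if_two_sided)
    have geom: "(\<lambda>n. C * q ^ n) summable_on UNIV" if "0 < q" "q < 1" for C q :: real
      using that by (intro summable_on_cmult_right norm_summable_imp_summable_on)
        (simp add: norm_power summable_geometric)
    have q: "0 < h powr (s - 1)" "0 < h powr (- s)" "h powr (s - 1) < 1" "h powr (- s) < 1"
      using h s by (auto simp: powr_less_one)
    have le1: "M B (int n) \<le> B * (h powr (s - 1)) ^ n" for n
      using h by (simp add: M_def v_def powr_powr powr_realpow[symmetric] mult.commute min.coboundedI2)
    have le2: "M B (- int n) \<le> 1 * (h powr (- s)) ^ n" for n
      using h by (simp add: M_def v_def powr_powr powr_realpow[symmetric] mult.commute min.coboundedI1)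
    have nonneg: "0 \<le> M B k" for k
      using B by (simp add: M_def)
    show "(\<lambda>n. M B (int n)) summable_on UNIV"
      by (rule summable_on_comparison_test[OF geom[OF q(1,3)] le1 nonneg])
    show "(\<lambda>n. M B (- int n)) summable_on UNIV"
      by (rule summable_on_comparison_test[OF geom[OF q(2,4)] le2 nonneg])
  qed
  have t_summable: "(\<lambda>k. t k x) summable_on UNIV" if "0 \<le> x" for x
    using t[of x x] that by (intro summable_on_comparison_test[OF M_summable[OF that]]) auto
  define G where "G x = infsum (\<lambda>k. t k x) UNIV" for x
  have G_mono: "G x \<le> G y" if "0 \<le> x" "x \<le> y" for x y
    unfolding G_def
  proof (rule infsum_mono)
    show "t k x \<le> t k y" for k
      using that v[of k] unfolding t_def by (intro mult_left_mono) (auto simp: field_simps)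
  qed (use that t_summable in auto)
  \<comment> \<open>Scaling the argument by \<open>v j\<close> amounts to shifting the summation
    index by \<open>j\<close>.\<close>
  have G_scale: "G (v j) = v j powr s * G 1" for j
  proof -
    have "t (k + j) (v j) = v j powr s * t k 1" for k
    proof -
      have "v (k + j) = v j * v k" by (simp add: v_def powr_add)
      moreover have "v j + v j * v k = v j * (1 + v k)" by algebra
      then have "v j / (v j + v j * v k) = 1 / (1 + v k)"
        using v[of j] by simp
      ultimately show ?thesis
        using v[of j] v[of k] by (simp add: t_def powr_mult)
    qed
    then have "G (v j) = infsum (\<lambda>k. v j powr s * t k 1) UNIV"
      unfolding G_def
      by (intro infsum_reindex_bij_witness[of _ "\<lambda>k. k + j" "\<lambda>k. k - j"])
         (auto simp del: mult_cancel_left, metis diff_add_cancel)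
    also have "\<dots> = v j powr s * G 1"
      unfolding G_def by (rule infsum_cmult_right')
    finally show ?thesis .
  qed
  have "t 0 1 \<le> G 1"
    using finite_sum_le_infsum[OF t_summable[of 1], of "{0}"] t(1)[of 1 1] by (simp add: G_def)
  then have G1: "G 1 > 0" using h by (simp add: t_def v_def)
  have G_approx: "\<bar>x powr s - G x / G 1\<bar> \<le> e / 2" if x: "0 \<le> x" "x \<le> R" for x
  proof (cases "x = 0")
    case True
    then show ?thesis using e by (simp add: G_def t_def)
  next
    case False
    define j where "j = \<lfloor>log h x\<rfloor>"
    \<comment> \<open>Between neighbouring powers of \<open>h\<close>, monotonicity places both
      \<open>x powr s\<close> and \<open>G x / G 1\<close> between \<open>v j powr s\<close> and
      \<open>1 + d\<close> times this value.\<close>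
    have w: "v j \<le> x" "x \<le> v (j + 1)"
      using x False h unfolding v_def j_def
      by (auto simp: le_log_iff[symmetric] log_le_iff[symmetric])
    have v1: "v (j + 1) powr s = (1 + d) * v j powr s"
      using h by (simp add: v_def powr_add powr_mult)
    have "v j powr s \<le> x powr s" "x powr s \<le> (1 + d) * v j powr s"
      using w v[of j] s x unfolding v1[symmetric] by (auto intro!: powr_mono2)
    moreover have "v j powr s * G 1 \<le> G x" "G x \<le> (1 + d) * v j powr s * G 1"
      using G_mono[OF _ w(1)] G_mono[OF x(1) w(2)] v[of j] unfolding v1[symmetric] G_scale by auto
    then have "v j powr s \<le> G x / G 1" "G x / G 1 \<le> (1 + d) * v j powr s"
      using G1 by (auto simp: field_simps)
    ultimately have "\<bar>x powr s - G x / G 1\<bar> \<le> d * v j powr s"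
      by (auto simp: abs_le_iff algebra_simps)
    also have "\<dots> \<le> d * R powr s"
      using d w x s v[of j] by (intro mult_left_mono powr_mono2) auto
    also have "\<dots> = e / 2" using R by (simp add: d_def)
    finally show ?thesis .
  qed
  have "(M R has_sum infsum (M R) UNIV) UNIV"
    using M_summable R by (intro has_sum_infsum) auto
  moreover have "e / 2 * G 1 > 0" using e G1 by simp
  ultimately have "\<forall>\<^sub>F F in finite_subsets_at_top UNIV. dist (sum (M R) F) (infsum (M R) UNIV) < e / 2 * G 1"
    unfolding has_sum_def by (rule tendstoD)
  then obtain F where F: "finite F" "dist (sum (M R) F) (infsum (M R) UNIV) < e / 2 * G 1"
    unfolding eventually_finite_subsets_at_top by blast
  \<comment> \<open>The tail at any \<open>x\<close> is dominated by the tail of \<open>M R\<close>,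
    so one finite set \<open>F\<close> works on the whole interval.\<close>
  have tail: "\<bar>G x - (\<Sum>k\<in>F. t k x)\<bar> \<le> e / 2 * G 1" if x: "0 \<le> x" "x \<le> R" for x
  proof -
    have "G x - (\<Sum>k\<in>F. t k x) = infsum (\<lambda>k. t k x) (UNIV - F)"
      unfolding G_def using F(1) x
      by (subst infsum_Diff) (auto intro: t_summable)
    moreover have "infsum (\<lambda>k. t k x) (UNIV - F) \<le> infsum (M R) (UNIV - F)"
      using x t(2)[OF x] R by (intro infsum_mono summable_on_subset_banach[OF t_summable]
          summable_on_subset_banach[OF M_summable]) auto
    moreover have "infsum (M R) (UNIV - F) = infsum (M R) UNIV - sum (M R) F"
      using F(1) R by (subst infsum_Diff) (auto intro: M_summable)
    moreover have "0 \<le> infsum (\<lambda>k. t k x) (UNIV - F)"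
      using t(1)[OF x] by (intro infsum_nonneg) auto
    ultimately show ?thesis using F(2) by (simp add: dist_real_def)
  qed
  have "\<bar>x powr s - (\<Sum>k\<in>F. v k powr s / G 1 * (x / (x + v k)))\<bar> \<le> e" if x: "0 \<le> x" "x \<le> R" for x
  proof -
    have "(\<Sum>k\<in>F. v k powr s / G 1 * (x / (x + v k))) = (\<Sum>k\<in>F. t k x) / G 1"
      unfolding t_def sum_divide_distrib by (intro sum.cong refl times_divide_eq_left)
    moreover have "\<bar>G x / G 1 - (\<Sum>k\<in>F. t k x) / G 1\<bar> \<le> e / 2"
    proof -
      have "\<bar>G x / G 1 - (\<Sum>k\<in>F. t k x) / G 1\<bar> = \<bar>G x - (\<Sum>k\<in>F. t k x)\<bar> / G 1"
        using G1 by (simp flip: diff_divide_distrib)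
      also have "\<dots> \<le> e / 2" using tail[OF x] G1 by (simp add: pos_divide_le_eq)
      finally show ?thesis .
    qed
    ultimately show ?thesis using G_approx[OF x] by linarith
  qed
  then show ?thesis
    using F(1) v G1
    by (intro exI[of _ F] exI[of _ "\<lambda>k. v k powr s / G 1"] exI[of _ v]) auto
qed

section \<open>Operator concavity and convexity of powers\<close>

lemma continuous_on_resolvent_functions:
  fixes u :: real
  assumes "u > 0"
  shows "continuous_on {0..} (\<lambda>x. u / (x + u))" "continuous_on {0..} (\<lambda>x. x / (x + u))"
  using assms by (auto intro!: continuous_intros)

text \<open>Here \<open>w0\<close> is u (T + u)^(-1) v, the critical point of the quadratic
  functional in \<open>w\<close>: it satisfies \<open>T w0 = u *\<^sub>R (v - w0)\<close>.
  Completing the square around it leaves \<open>inner d (T d) + u * (norm d)\<^sup>2\<close> with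
  \<open>d = w - w0\<close>, which is nonnegative.\<close>

lemma op_fun_resolvent_variational:
  fixes T :: "'a::complex_hilbert_space \<Rightarrow>\<^sub>L 'a"
    and v w :: 'a
  assumes T: "positive_op T" and u: "u > 0"
  defines "w0 \<equiv> op_fun (\<lambda>x. u / (x + u)) T v"
  shows "u * inner v (op_fun (\<lambda>x. x / (x + u)) T v) = inner w0 (T w0) + u * (norm (v - w0))\<^sup>2"
    and "u * inner v (op_fun (\<lambda>x. x / (x + u)) T v) \<le> inner w (T w) + u * (norm (v - w))\<^sup>2"
proof -
  note cont = continuous_on_resolvent_functions[OF u]
  let ?G = "op_fun (\<lambda>x. u / (x + u)) T"
  \<comment> \<open>The resolvent equation is obtained inside the functional calculus, from the
    scalar identity x u / (x + u) = u (1 - u / (x + u)).\<close>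
  have "op_fun (\<lambda>x. x * (u / (x + u))) T = op_fun (\<lambda>x. u * (1 - u / (x + u))) T"
    using u by (intro op_fun_cong T) (simp add: field_simps)
  moreover have "op_fun (\<lambda>x. x * (u / (x + u))) T = T o\<^sub>L ?G"
    by (simp only: op_fun_mult[OF T continuous_on_id cont(1)] op_fun_ident[OF T])
  moreover have one: "op_fun (\<lambda>x. 1 - u / (x + u)) T = id_blinfun - ?G"
    by (subst op_fun_diff[OF T _ cont(1)]) (simp_all add: op_fun_const[OF T])
  moreover have "op_fun (\<lambda>x. u * (1 - u / (x + u))) T = u *\<^sub>R op_fun (\<lambda>x. 1 - u / (x + u)) T"
    by (intro op_fun_cmult T continuous_intros cont)
  ultimately have "T o\<^sub>L ?G = u *\<^sub>R (id_blinfun - ?G)" by simp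
  from arg_cong[OF this, of "\<lambda>S. S v"]
  have Tw0: "T w0 = u *\<^sub>R (v - w0)"
    by (simp add: w0_def scaleR_blinfun.rep_eq minus_blinfun.rep_eq)
  have "op_fun (\<lambda>x. x / (x + u)) T = op_fun (\<lambda>x. 1 - u / (x + u)) T"
    using u by (intro op_fun_cong T) (simp add: field_simps)
  then have F: "op_fun (\<lambda>x. x / (x + u)) T v = v - w0"
    by (simp add: one w0_def minus_blinfun.rep_eq)
  show eq: "u * inner v (op_fun (\<lambda>x. x / (x + u)) T v) = inner w0 (T w0) + u * (norm (v - w0))\<^sup>2"
    unfolding F Tw0 by (simp add: power2_norm_eq_inner inner_diff_left inner_diff_right algebra_simps)
  define d where "d = w - w0"
  have w: "w = w0 + d" by (simp add: d_def)
  have "inner w0 (T d) = inner d (T w0)"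
    using selfadjoint_op_inner[OF positive_op_imp_selfadjoint[OF T], of d w0]
    by (simp add: inner_commute)
  then have "inner w (T w) + u * (norm (v - w))\<^sup>2 =
      inner w0 (T w0) + u * (norm (v - w0))\<^sup>2 + inner d (T d) + u * (norm d)\<^sup>2"
    unfolding w power2_norm_eq_inner
    by (simp add: blinfun.add_right inner_add_left inner_add_right inner_diff_left inner_diff_right
        Tw0 inner_commute algebra_simps)
  then show "u * inner v (op_fun (\<lambda>x. x / (x + u)) T v) \<le> inner w (T w) + u * (norm (v - w))\<^sup>2"
    using positive_op_inner[OF T, of d] u unfolding eq by simp
qed

text \<open>Nonnegative for all data exactly when \<open>f\<close> is operator concave. It is
  treated as a functional of \<open>f\<close>: on continuous functions it is linear and continuous
  in the supremum norm, so a sign can be carried from the resolvent functions to sums and uniform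
  limits.\<close>

definition jensen_gap where
  "jensen_gap l Y Z v f = inner v (op_fun f ((1 - l) *\<^sub>R Y + l *\<^sub>R Z) v)
     - (1 - l) * inner v (op_fun f Y v) - l * inner v (op_fun f Z v)"

context
  fixes Y Z :: "'a::complex_hilbert_space \<Rightarrow>\<^sub>L 'a" and l :: real and v :: 'a
  assumes Y: "positive_op Y" and Z: "positive_op Z" and l: "0 \<le> l" "l \<le> 1"
begin

lemma positive_op_convex_combination: "positive_op ((1 - l) *\<^sub>R Y + l *\<^sub>R Z)"
  using l by (intro positive_op_add positive_op_scaleR Y Z) auto

lemmas jensen_pos = Y Z positive_op_convex_combination

lemma jensen_gap_ident: "jensen_gap l Y Z v (\<lambda>x. x) = 0"
  by (simp add: jensen_gap_def op_fun_ident jensen_pos plus_blinfun.rep_eq scaleR_blinfun.rep_eq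
      inner_add_right)

lemma jensen_gap_diff:
  "continuous_on {0..} f \<Longrightarrow> continuous_on {0..} g \<Longrightarrow>
    jensen_gap l Y Z v (\<lambda>x. f x - g x) = jensen_gap l Y Z v f - jensen_gap l Y Z v g"
  unfolding jensen_gap_def
  by (simp only: op_fun_diff jensen_pos minus_blinfun.rep_eq inner_diff_right) algebra

lemma jensen_gap_cmult:
  "continuous_on {0..} f \<Longrightarrow> jensen_gap l Y Z v (\<lambda>x. a * f x) = a * jensen_gap l Y Z v f"
  unfolding jensen_gap_def
  by (simp only: op_fun_cmult jensen_pos scaleR_blinfun.rep_eq inner_scaleR_right) algebra

lemma jensen_gap_sum:
  assumes "\<And>i. i \<in> I \<Longrightarrow> continuous_on {0..} (f i)"
  shows "jensen_gap l Y Z v (\<lambda>x. \<Sum>i\<in>I. f i x) = (\<Sum>i\<in>I. jensen_gap l Y Z v (f i))"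
  using assms
  by (simp add: jensen_gap_def op_fun_sum jensen_pos blinfun.sum_left inner_sum_right
      sum_subtractf sum_distrib_left)

lemma jensen_gap_cong:
  "(\<And>x. 0 \<le> x \<Longrightarrow> f x = g x) \<Longrightarrow> jensen_gap l Y Z v f = jensen_gap l Y Z v g"
  unfolding jensen_gap_def
  by (simp add: op_fun_cong[OF Y, of f g] op_fun_cong[OF Z, of f g]
      op_fun_cong[OF positive_op_convex_combination, of f g])

text \<open>The three operators have norm at most the larger of the two given norms. The factor 2 is
  the sum of the weights 1, \<open>1 - l\<close> and \<open>l\<close> of the three terms.\<close>

lemma abs_jensen_gap_le:
  assumes f: "continuous_on {0..} f"
    and le: "\<And>x. 0 \<le> x \<Longrightarrow> x \<le> max (norm Y) (norm Z) \<Longrightarrow> \<bar>f x\<bar> \<le> c"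
  shows "\<bar>jensen_gap l Y Z v f\<bar> \<le> 2 * c * (norm v)\<^sup>2"
proof -
  let ?m = "max (norm Y) (norm Z)"
  have form: "\<bar>inner v (op_fun f T v)\<bar> \<le> c * (norm v)\<^sup>2" if "positive_op T" "norm T \<le> ?m" for T
  proof -
    have "norm (op_fun f T) \<le> c"
      using that le by (intro norm_op_fun_le f) auto
    then have "norm v * norm (op_fun f T v) \<le> norm v * (c * norm v)"
      by (intro mult_left_mono order_trans[OF norm_blinfun] mult_right_mono) auto
    with Cauchy_Schwarz_ineq2[of v "op_fun f T v"] show ?thesis
      by (simp add: power2_eq_square mult_ac)
  qed
  have "norm ((1 - l) *\<^sub>R Y + l *\<^sub>R Z) \<le> (1 - l) * norm Y + l * norm Z"
    using l norm_triangle_ineq[of "(1 - l) *\<^sub>R Y" "l *\<^sub>R Z"] by simp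
  also have "\<dots> \<le> (1 - l) * ?m + l * ?m"
    using l by (intro add_mono mult_left_mono) auto
  also have "\<dots> = ?m" by (simp add: algebra_simps)
  finally have "\<bar>inner v (op_fun f ((1 - l) *\<^sub>R Y + l *\<^sub>R Z) v)\<bar> \<le> c * (norm v)\<^sup>2"
    by (intro form jensen_pos)
  moreover have "\<bar>(1 - l) * inner v (op_fun f Y v)\<bar> \<le> (1 - l) * (c * (norm v)\<^sup>2)"
    using l form[OF Y] by (simp add: abs_mult mult_left_mono)
  moreover have "\<bar>l * inner v (op_fun f Z v)\<bar> \<le> l * (c * (norm v)\<^sup>2)"
    using l form[OF Z] by (simp add: abs_mult mult_left_mono)
  moreover have "(1 - l) * (c * (norm v)\<^sup>2) + l * (c * (norm v)\<^sup>2) = c * (norm v)\<^sup>2"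
    by (simp add: algebra_simps)
  ultimately show ?thesis
    unfolding jensen_gap_def by linarith
qed

lemma jensen_gap_resolvent_nonneg:
  assumes u: "u > 0"
  shows "0 \<le> jensen_gap l Y Z v (\<lambda>x. x / (x + u))"
proof -
  let ?X = "(1 - l) *\<^sub>R Y + l *\<^sub>R Z" and ?f = "\<lambda>x. x / (x + u)"
  \<comment> \<open>The minimizer at \<open>?X\<close> is only a competitor at \<open>Y\<close> and
    at \<open>Z\<close>, which gives the inequality in the right direction.\<close>
  define w where "w = op_fun (\<lambda>x. u / (x + u)) ?X v"
  have "u * inner v (op_fun ?f ?X v) = inner w (?X w) + u * (norm (v - w))\<^sup>2"
    unfolding w_def by (rule op_fun_resolvent_variational[OF positive_op_convex_combination u])
  also have "\<dots> = (1 - l) * (inner w (Y w) + u * (norm (v - w))\<^sup>2) +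
      l * (inner w (Z w) + u * (norm (v - w))\<^sup>2)"
    by (simp only: plus_blinfun.rep_eq scaleR_blinfun.rep_eq inner_add_right inner_scaleR_right)
       algebra
  also have "\<dots> \<ge> (1 - l) * (u * inner v (op_fun ?f Y v)) + l * (u * inner v (op_fun ?f Z v))"
    using l by (intro add_mono mult_left_mono op_fun_resolvent_variational Y Z u) auto
  finally have "0 \<le> u * jensen_gap l Y Z v ?f"
    by (simp add: jensen_gap_def algebra_simps)
  with u show ?thesis by (simp add: zero_le_mult_iff)
qed

lemma jensen_gap_powr:
  assumes s: "0 < s" "s < 1"
  shows "0 \<le> jensen_gap l Y Z v (\<lambda>x. x powr s)"
    and "jensen_gap l Y Z v (\<lambda>x. x * x powr s) \<le> 0"
proof -
  \<comment> \<open>The summand 1 keeps \<open>R\<close> positive even if both operators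
    vanish.\<close>
  define R where "R = max (norm Y) (norm Z) + 1"
  have R: "R > 0" by (simp add: R_def add_nonneg_pos max_def)
  note cont = continuous_on_powr_atLeast_0[OF s(1)]
  have approx: "- (2 * e * (norm v)\<^sup>2) \<le> jensen_gap l Y Z v (\<lambda>x. x powr s) \<and>
      jensen_gap l Y Z v (\<lambda>x. x * x powr s) \<le> 2 * (R * e) * (norm v)\<^sup>2" if e: "e > 0" for e
  proof -
    obtain F :: "int set" and c w where F: "\<And>k. k \<in> F \<Longrightarrow> 0 \<le> c k" "\<And>k. k \<in> F \<Longrightarrow> 0 < w k"
      and close: "\<And>x. x \<in> {0..R} \<Longrightarrow> \<bar>x powr s - (\<Sum>k\<in>F. c k * (x / (x + w k)))\<bar> \<le> e"
      using powr_approx_resolvent_sums[OF s R e] by blast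
    note cont_res = continuous_on_resolvent_functions(2)[OF F(2)]
    define g where "g x = (\<Sum>k\<in>F. c k * (x / (x + w k)))" for x
    have cont_g: "continuous_on {0..} g"
      unfolding g_def by (intro continuous_intros cont_res)
    have "jensen_gap l Y Z v g = (\<Sum>k\<in>F. c k * jensen_gap l Y Z v (\<lambda>x. x / (x + w k)))"
      unfolding g_def
      by (subst jensen_gap_sum)
         (auto intro!: continuous_on_mult_left cont_res sum.cong jensen_gap_cmult
           simp del: times_divide_eq_right)
    also have "\<dots> \<ge> 0"
      using F by (intro sum_nonneg mult_nonneg_nonneg jensen_gap_resolvent_nonneg) auto
    finally have g: "0 \<le> jensen_gap l Y Z v g" .
    \<comment> \<open>The gap of the identity function is zero, so subtracting a multiple of the
      resolvent function reverses the sign.\<close>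
    have res: "jensen_gap l Y Z v (\<lambda>x. x * (x / (x + w k))) \<le> 0" if "k \<in> F" for k
    proof -
      have "jensen_gap l Y Z v (\<lambda>x. x * (x / (x + w k))) =
          jensen_gap l Y Z v (\<lambda>x. x - w k * (x / (x + w k)))"
        using F(2)[OF that] by (intro jensen_gap_cong) (simp add: field_simps)
      also have "\<dots> = - (w k * jensen_gap l Y Z v (\<lambda>x. x / (x + w k)))"
        using cont_res[OF that]
        by (subst jensen_gap_diff)
           (auto intro!: continuous_on_mult_left simp: jensen_gap_ident jensen_gap_cmult
             simp del: times_divide_eq_right)
      finally show ?thesis
        using F(2)[OF that] jensen_gap_resolvent_nonneg[OF F(2)[OF that]] by simp
    qed
    have "jensen_gap l Y Z v (\<lambda>x. x * g x) =
        jensen_gap l Y Z v (\<lambda>x. \<Sum>k\<in>F. c k * (x * (x / (x + w k))))"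
      by (intro jensen_gap_cong) (simp add: g_def sum_distrib_left mult_ac)
    also have "\<dots> = (\<Sum>k\<in>F. c k * jensen_gap l Y Z v (\<lambda>x. x * (x / (x + w k))))"
      by (subst jensen_gap_sum)
         (auto intro!: continuous_on_mult_left continuous_on_mult continuous_on_id cont_res
           sum.cong jensen_gap_cmult simp del: times_divide_eq_right)
    also have "\<dots> \<le> 0"
      using F res by (intro sum_nonpos) (auto intro: mult_nonneg_nonpos)
    finally have xg: "jensen_gap l Y Z v (\<lambda>x. x * g x) \<le> 0" .
    have "\<bar>jensen_gap l Y Z v (\<lambda>x. x powr s - g x)\<bar> \<le> 2 * e * (norm v)\<^sup>2"
      using close by (intro abs_jensen_gap_le continuous_on_diff continuous_on_mult continuous_on_id cont cont_g)
        (auto simp: R_def g_def)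
    \<comment> \<open>The same \<open>g\<close> serves both powers; multiplication by
      \<open>x\<close> enlarges the error at most by the factor \<open>R\<close>.\<close>
    moreover have "\<bar>jensen_gap l Y Z v (\<lambda>x. x * x powr s - x * g x)\<bar> \<le> 2 * (R * e) * (norm v)\<^sup>2"
    proof (intro abs_jensen_gap_le continuous_on_diff continuous_on_mult continuous_on_id cont cont_g)
      fix x assume x: "0 \<le> x" "x \<le> max (norm Y) (norm Z)"
      then have "\<bar>x\<bar> * \<bar>x powr s - g x\<bar> \<le> R * e"
        using close[of x] by (intro mult_mono) (auto simp: R_def g_def)
      then show "\<bar>x * x powr s - x * g x\<bar> \<le> R * e"
        by (simp add: abs_mult flip: right_diff_distrib)
    qed
    ultimately show ?thesis
      using g xg by (simp add: jensen_gap_diff continuous_on_mult continuous_on_id cont cont_g)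
        (intro conjI; linarith)
  qed
  \<comment> \<open>The error bounds hold for every positive \<open>e\<close>; both signs follow as
    \<open>e\<close> tends to 0 from the right.\<close>
  have lim: "((\<lambda>e::real. C * e * (norm v)\<^sup>2) \<longlongrightarrow> C * 0 * (norm v)\<^sup>2) (at_right 0)" for C
    by (intro tendsto_intros)
  have ev: "\<forall>\<^sub>F e::real in at_right 0. e > 0"
    by (simp add: eventually_at_right_less)
  show "0 \<le> jensen_gap l Y Z v (\<lambda>x. x powr s)"
    using tendsto_upperbound[OF lim[of "-2"], of "jensen_gap l Y Z v (\<lambda>x. x powr s)"]
      eventually_mono[OF ev, of "\<lambda>e. -2 * e * (norm v)\<^sup>2 \<le> jensen_gap l Y Z v (\<lambda>x. x powr s)"] approx
    by simp
  show "jensen_gap l Y Z v (\<lambda>x. x * x powr s) \<le> 0"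
    using tendsto_lowerbound[OF lim[of "2 * R"], of "jensen_gap l Y Z v (\<lambda>x. x * x powr s)"]
      eventually_mono[OF ev, of "\<lambda>e. jensen_gap l Y Z v (\<lambda>x. x * x powr s) \<le> 2 * R * e * (norm v)\<^sup>2"] approx
    by (simp add: mult.assoc)
qed

lemma op_powr_concave:
  assumes s: "0 < s" "s \<le> 1"
  shows "(1 - l) * inner v (op_powr Y s v) + l * inner v (op_powr Z s v)
    \<le> inner v (op_powr ((1 - l) *\<^sub>R Y + l *\<^sub>R Z) s v)"
proof (cases "s = 1")
  case True
  then show ?thesis
    by (simp add: op_powr_one jensen_pos plus_blinfun.rep_eq scaleR_blinfun.rep_eq inner_add_right)
next
  case False
  with jensen_gap_powr(1)[of s] s show ?thesis
    by (simp add: jensen_gap_def op_powr_def)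
qed

lemma op_powr_convex:
  assumes s: "1 \<le> s" "s \<le> 2"
  shows "inner v (op_powr ((1 - l) *\<^sub>R Y + l *\<^sub>R Z) s v)
    \<le> (1 - l) * inner v (op_powr Y s v) + l * inner v (op_powr Z s v)"
proof -
  consider "s = 1" | "s = 2" | "0 < s - 1" "s - 1 < 1" using s by linarith
  then show ?thesis
  proof cases
    case 1
    then show ?thesis
      by (simp add: op_powr_one jensen_pos plus_blinfun.rep_eq scaleR_blinfun.rep_eq inner_add_right)
  next
    case 2
    have sq: "inner v (op_powr T 2 v) = (norm (T v))\<^sup>2" if "positive_op T" for T
      using op_powr_add[OF that, of 1 1]
      by (simp add: op_powr_one that power2_norm_eq_inner
          selfadjoint_op_inner[OF positive_op_imp_selfadjoint[OF that], of v]
          flip: blinfun_apply_blinfun_compose)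
    \<comment> \<open>At the endpoint 2 the power is a square, and its convexity is that of the
      squared norm, with an explicit defect.\<close>
    have "(1 - l) * (norm (Y v))\<^sup>2 + l * (norm (Z v))\<^sup>2 - (norm ((1 - l) *\<^sub>R Y v + l *\<^sub>R Z v))\<^sup>2 =
        (1 - l) * l * (norm (Y v - Z v))\<^sup>2"
      unfolding power2_norm_eq_inner
      by (simp add: inner_add_left inner_add_right inner_diff_left inner_diff_right inner_commute
          algebra_simps power2_eq_square)
    also have "\<dots> \<ge> 0" using l by simp
    finally show ?thesis
      by (simp add: 2 sq jensen_pos plus_blinfun.rep_eq scaleR_blinfun.rep_eq)
  next
    case 3
    have "jensen_gap l Y Z v (\<lambda>x. x * x powr (s - 1)) = jensen_gap l Y Z v (\<lambda>x. x powr s)"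
      by (intro jensen_gap_cong) (auto simp: powr_mult_base)
    with jensen_gap_powr(2)[OF 3] show ?thesis
      by (simp add: jensen_gap_def op_powr_def)
  qed
qed

end

section \<open>Hilbert-Schmidt sums and the trace\<close>

lemma cinner_sum_left: "cinner (sum f F) x = (\<Sum>i\<in>F. cinner (f i) x)"
  for x :: "'a::complex_hilbert_space"
  by (induction F rule: infinite_finite_induct) (auto simp: cinner_add_left)

lemma cmod_cinner_commute: "cmod (cinner x y) = cmod (cinner y x)"
  for x y :: "'a::complex_hilbert_space"
  by (metis cinner_commute complex_mod_cnj)

context
  fixes E :: "'a::complex_hilbert_space set" and x :: 'a
  assumes onb: "onb E"
begin

lemma cinner_onb: "e \<in> E \<Longrightarrow> f \<in> E \<Longrightarrow> cinner e f = (if e = f then 1 else 0)"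
  using onb by (auto simp: onb_def cinner_self)

lemma cinner_onb_sum:
  assumes "finite F" "F \<subseteq> E" "e \<in> E"
  shows "cinner e (\<Sum>f\<in>F. cinner f x *\<^sub>C f) = (if e \<in> F then cinner e x else 0)"
proof -
  have "cinner e (\<Sum>f\<in>F. cinner f x *\<^sub>C f) = (\<Sum>f\<in>F. if e = f then cinner f x else 0)"
    unfolding cinner_sum_right cinner_scaleC_right
    using assms by (intro sum.cong) (auto simp: cinner_onb subset_iff)
  then show ?thesis using assms(1) by simp
qed

lemma norm_onb_sum:
  assumes "finite F" "F \<subseteq> E"
  shows "(norm (\<Sum>f\<in>F. cinner f x *\<^sub>C f))\<^sup>2 = (\<Sum>f\<in>F. (cmod (cinner f x))\<^sup>2)"
proof -
  let ?y = "\<Sum>f\<in>F. cinner f x *\<^sub>C f"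
  have "complex_of_real ((norm ?y)\<^sup>2) = (\<Sum>f\<in>F. cnj (cinner f x) * cinner f ?y)"
    by (simp only: cinner_self[symmetric] cinner_sum_left cinner_scaleC_left)
  also have "\<dots> = (\<Sum>f\<in>F. cnj (cinner f x) * cinner f x)"
    using assms by (intro sum.cong refl) (simp add: cinner_onb_sum subset_iff)
  also have "\<dots> = complex_of_real (\<Sum>f\<in>F. (cmod (cinner f x))\<^sup>2)"
    unfolding of_real_sum
    by (intro sum.cong refl) (simp only: complex_norm_square mult.commute)
  finally show ?thesis using of_real_eq_iff by blast
qed

lemma norm_diff_onb_sum:
  assumes "finite F" "F \<subseteq> E"
  shows "(norm (x - (\<Sum>f\<in>F. cinner f x *\<^sub>C f)))\<^sup>2 = (norm x)\<^sup>2 - (\<Sum>f\<in>F. (cmod (cinner f x))\<^sup>2)"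
proof -
  let ?y = "\<Sum>f\<in>F. cinner f x *\<^sub>C f"
  have "cinner ?y x = (\<Sum>f\<in>F. cnj (cinner f x) * cinner f x)"
    by (simp only: cinner_sum_left cinner_scaleC_left)
  also have "\<dots> = complex_of_real (\<Sum>f\<in>F. (cmod (cinner f x))\<^sup>2)"
    unfolding of_real_sum
    by (intro sum.cong refl) (simp only: complex_norm_square mult.commute)
  finally have "inner ?y x = (\<Sum>f\<in>F. (cmod (cinner f x))\<^sup>2)"
    by (simp add: inner_eq_Re_cinner)
  moreover have "(norm (x - ?y))\<^sup>2 = (norm x)\<^sup>2 - 2 * inner ?y x + (norm ?y)\<^sup>2"
    unfolding power2_norm_eq_inner by (simp add: inner_diff_left inner_diff_right inner_commute)
  ultimately show ?thesis
    using norm_onb_sum[OF assms] by simp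
qed

text \<open>The basis may be uncountable. Bessel's inequality makes the squared coefficients
  summable with some sum \<open>s\<close>; an increasing sequence of finite subsets nearly
  exhausting \<open>s\<close> gives partial expansions that form a Cauchy sequence. Their limit
  differs from \<open>x\<close> by a vector orthogonal to the basis, which is zero by maximality,
  and this forces \<open>s = (norm x)\<^sup>2\<close>.\<close>

lemma Parseval: "((\<lambda>e. (cmod (cinner e x))\<^sup>2) has_sum (norm x)\<^sup>2) E"
proof -
  define a where "a e = (cmod (cinner e x))\<^sup>2" for e
  have a: "0 \<le> a e" for e by (simp add: a_def)
  have "sum a F \<le> (norm x)\<^sup>2" if "finite F" "F \<subseteq> E" for F
    using norm_diff_onb_sum[OF that] zero_le_power2[of "norm (x - (\<Sum>f\<in>F. cinner f x *\<^sub>C f))"]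
    unfolding a_def by linarith
  then have "a summable_on E"
    by (intro nonneg_bdd_above_summable_on) (auto simp: a bdd_above_def)
  define s where "s = infsum a E"
  have s: "(a has_sum s) E"
    unfolding s_def by (rule has_sum_infsum) fact
  have sum_le: "sum a F \<le> s" if "finite F" "F \<subseteq> E" for F
    by (rule finite_sum_le_has_sum[OF s that]) (simp add: a)
  have "\<exists>F. finite F \<and> F \<subseteq> E \<and> s - sum a F < 1 / real (Suc n)" for n
  proof -
    have "\<forall>\<^sub>F F in finite_subsets_at_top E. dist (sum a F) s < 1 / real (Suc n)"
      using s unfolding has_sum_def by (rule tendstoD) simp
    then obtain F where "finite F" "F \<subseteq> E" "dist (sum a F) s < 1 / real (Suc n)"
      unfolding eventually_finite_subsets_at_top by blast
    then show ?thesis by (intro exI[of _ F]) (auto simp: dist_real_def)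
  qed
  then obtain F where F: "\<And>n. finite (F n)" "\<And>n. F n \<subseteq> E" "\<And>n. s - sum a (F n) < 1 / real (Suc n)"
    by metis
  \<comment> \<open>Unions make the sets nested, so that the difference of two partial expansions is
    again an orthogonal sum, of squared norm less than the missing tail.\<close>
  define H where "H n = (\<Union>k\<le>n. F k)" for n
  have H: "finite (H n)" "H n \<subseteq> E" for n
    using F by (auto simp: H_def)
  have H_mono: "H n \<subseteq> H m" if "n \<le> m" for n m
    using that by (force simp: H_def)
  have H_close: "s - sum a (H n) < 1 / real (Suc n)" for n
  proof -
    have "sum a (F n) \<le> sum a (H n)"
      by (intro sum_mono2 H a) (auto simp: H_def)
    with F(3)[of n] show ?thesis by linarith
  qed
  have lim0: "(\<lambda>n. 1 / real (Suc n)) \<longlonglongrightarrow> 0"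
    using lim_inverse_n' LIMSEQ_Suc by blast
  define y where "y n = (\<Sum>f\<in>H n. cinner f x *\<^sub>C f)" for n
  have y_diff: "(norm (y m - y n))\<^sup>2 < 1 / real (Suc n)" if "n \<le> m" for n m
  proof -
    have "y m - y n = (\<Sum>f\<in>H m - H n. cinner f x *\<^sub>C f)"
      unfolding y_def by (simp add: sum_diff H H_mono[OF that])
    then have "(norm (y m - y n))\<^sup>2 = sum a (H m - H n)"
      using norm_onb_sum[of "H m - H n"] H by (auto simp: a_def)
    also have "\<dots> = sum a (H m) - sum a (H n)"
      by (simp add: sum_diff H H_mono[OF that])
    also have "\<dots> < 1 / real (Suc n)"
      using H_close[of n] sum_le[OF H, of m] by linarith
    finally show ?thesis .
  qed
  have "Cauchy y"
  proof (rule metric_CauchyI)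
    fix e :: real assume e: "e > 0"
    then have "e\<^sup>2 / 4 > 0" by simp
    from order_tendstoD(2)[OF lim0 this]
    obtain N where N: "1 / real (Suc N) < e\<^sup>2 / 4"
      unfolding eventually_sequentially by blast
    have near: "dist (y m) (y N) < e / 2" if "m \<ge> N" for m
    proof -
      have "(dist (y m) (y N))\<^sup>2 < (e / 2)\<^sup>2"
        using y_diff[OF that] N by (simp add: dist_norm power_divide)
      then show ?thesis using e by (intro power2_less_imp_less[of _ "e / 2"]) auto
    qed
    have "dist (y m) (y n) < e" if "m \<ge> N" "n \<ge> N" for m n
      using near[OF that(1)] near[OF that(2)] dist_triangle2[of "y m" "y n" "y N"] by linarith
    then show "\<exists>M. \<forall>m\<ge>M. \<forall>n\<ge>M. dist (y m) (y n) < e" by blast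
  qed
  then obtain z where z: "y \<longlonglongrightarrow> z"
    using Cauchy_convergent convergent_def by blast
  have "cinner e (x - z) = 0" if e: "e \<in> E" for e
  proof -
    \<comment> \<open>Inside \<open>H n\<close> the coefficient of the difference vanishes; outside,
      it is the coefficient of \<open>x\<close> and belongs to the tail that \<open>H n\<close>
      leaves.\<close>
    have "(cmod (cinner e (x - y n)))\<^sup>2 \<le> 1 / real (Suc n)" for n
    proof (cases "e \<in> H n")
      case True
      then show ?thesis
        using e H by (simp add: y_def cinner_diff_right cinner_onb_sum)
    next
      case False
      then have "a e + sum a (H n) \<le> s"
        using sum_le[of "insert e (H n)"] e H by simp
      then have "a e \<le> 1 / real (Suc n)" using H_close[of n] by linarith
      then show ?thesis
        using e H False by (simp add: y_def cinner_diff_right cinner_onb_sum a_def)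
    qed
    moreover have "(\<lambda>n. (cmod (cinner e (x - y n)))\<^sup>2) \<longlonglongrightarrow> (cmod (cinner e (x - z)))\<^sup>2"
      by (intro tendsto_intros bounded_linear.tendsto[OF bounded_linear_cinner_right] z)
    ultimately have "(cmod (cinner e (x - z)))\<^sup>2 \<le> 0"
      using LIMSEQ_le[OF _ lim0] by blast
    then show ?thesis by simp
  qed
  then have "x - z = 0"
    using onb unfolding onb_def by blast
  then have "(\<lambda>n. (norm (x - y n))\<^sup>2) \<longlonglongrightarrow> (norm (x - x))\<^sup>2"
    using z by (intro tendsto_intros) simp
  then have "(\<lambda>n. (norm x)\<^sup>2 - sum a (H n)) \<longlonglongrightarrow> 0"
    using H by (simp add: y_def norm_diff_onb_sum a_def)
  moreover have "(\<lambda>n. s - sum a (H n)) \<longlonglongrightarrow> 0"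
    using H_close sum_le[OF H]
    by (intro tendsto_sandwich[OF _ _ tendsto_const lim0]) (auto intro!: always_eventually less_imp_le)
  ultimately have "(\<lambda>n. ((norm x)\<^sup>2 - sum a (H n)) - (s - sum a (H n))) \<longlonglongrightarrow> 0 - 0"
    by (rule tendsto_diff)
  then have "(norm x)\<^sup>2 = s" by (simp add: LIMSEQ_const_iff)
  with s show ?thesis by (simp add: a_def[abs_def])
qed

end

text \<open>Both sums equal the double sum of the squared matrix entries: Parseval in
  \<open>F\<close>, an interchange of nonnegative sums, then Parseval in \<open>E\<close>. Hence the
  Hilbert-Schmidt norm is independent of the basis and invariant under taking adjoints.\<close>

lemma has_sum_norm_square_adjoint:
  fixes S T :: "'a::complex_hilbert_space \<Rightarrow>\<^sub>L 'a"
  assumes adj: "\<And>x y. cinner (S x) y = cinner x (T y)"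
    and E: "onb E" and F: "onb F" and S: "((\<lambda>e. (norm (S e))\<^sup>2) has_sum c) E"
  shows "((\<lambda>f. (norm (T f))\<^sup>2) has_sum c) F"
proof -
  let ?a = "\<lambda>(e, f). (cmod (cinner f (S e)))\<^sup>2"
  have inner_sum: "((\<lambda>f. ?a (e, f)) has_sum (norm (S e))\<^sup>2) F" for e
    using Parseval[OF F, of "S e"] by simp
  have "?a summable_on (E \<times> F)"
    using has_sum_imp_summable[OF S] by (intro summable_on_SigmaI[OF inner_sum]) auto
  then have "(?a has_sum c) (E \<times> F)"
    by (intro has_sum_SigmaI[OF inner_sum S])
  then have "((\<lambda>(f, e). ?a (e, f)) has_sum c) (F \<times> E)"
    by (subst (asm) has_sum_swap)
  moreover have "((\<lambda>e. (\<lambda>(f, e). ?a (e, f)) (f, e)) has_sum (norm (T f))\<^sup>2) E" for f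
    using Parseval[OF E, of "T f"] by (simp add: adj[symmetric] cmod_cinner_commute[of f])
  ultimately show ?thesis by (rule has_sum_SigmaD)
qed

text \<open>The diagonal entries of the square are squared norms, so basis independence of the
  Hilbert-Schmidt norm, with \<open>C\<close> as its own adjoint, supplies the common value that the
  definition of the trace asks for.\<close>

lemma op_trace_square:
  fixes C :: "'a::complex_hilbert_space \<Rightarrow>\<^sub>L 'a"
  assumes C: "selfadjoint_op C" and E: "onb E" and c: "((\<lambda>e. (norm (C e))\<^sup>2) has_sum c) E"
  shows "op_trace (op_power C 2) = complex_of_real c"
proof -
  have diag: "cinner e (op_power C 2 e) = complex_of_real ((norm (C e))\<^sup>2)" for e
    by (simp add: op_power_2 selfadjoint_opD[OF C, symmetric] cinner_self)
  have sum: "((\<lambda>e. cinner e (op_power C 2 e)) has_sum complex_of_real c) F" if "onb F" for F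
    unfolding diag
    by (intro has_sum_of_real has_sum_norm_square_adjoint[OF selfadjoint_opD[OF C] E that c])
  show ?thesis
    unfolding op_trace_def
  proof (rule the_equality)
    fix c' assume "\<forall>E. onb E \<longrightarrow> ((\<lambda>e. cinner e (op_power C 2 e)) has_sum c') E"
    with E sum[OF E] show "c' = complex_of_real c" using has_sum_unique by blast
  qed (use sum in blast)
qed

lemma has_sum_inner_polarization:
  fixes f g :: "'b \<Rightarrow> 'a::real_inner"
  assumes "((\<lambda>e. (norm (f e + g e))\<^sup>2) has_sum a) E" "((\<lambda>e. (norm (f e - g e))\<^sup>2) has_sum b) E"
  shows "((\<lambda>e. inner (f e) (g e)) has_sum (a - b) / 4) E"
proof -
  have eq: "inner x y = ((norm (x + y))\<^sup>2 + - (norm (x - y))\<^sup>2) * (1 / 4)" for x y :: 'a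
    unfolding power2_norm_eq_inner
    by (simp add: inner_add_left inner_add_right inner_diff_left inner_diff_right inner_commute)
  have "((\<lambda>e. ((norm (f e + g e))\<^sup>2 + - (norm (f e - g e))\<^sup>2) * (1 / 4)) has_sum
      (a + - b) * (1 / 4)) E"
    by (intro has_sum_cmult_left has_sum_add assms has_sum_uminusI)
  moreover have "(a + - b) * (1 / 4) = (a - b) / 4" by simp
  ultimately show ?thesis unfolding eq by simp
qed

text \<open>Cyclicity of the trace turns \<open>Tr (C\<^sup>2 D)\<close> into \<open>Tr (C D C)\<close>.\<close>

lemma has_sum_inner_square_nonneg:
  fixes C D :: "'a::complex_hilbert_space \<Rightarrow>\<^sub>L 'a"
  assumes C: "selfadjoint_op C" and D: "positive_op D" and E: "onb E"
    and hs: "(\<lambda>e. (norm (C e))\<^sup>2) summable_on E"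
  shows "\<exists>r\<ge>0. ((\<lambda>e. inner (C (C e)) (D e)) has_sum r) E"
proof -
  note D' = positive_op_imp_selfadjoint[OF D]
  \<comment> \<open>The operators C + DC and C + CD are adjoint to each other, as are C - DC and C -
    CD, so each pair has equal Hilbert-Schmidt norms. Polarization turns this into equality of the
    sums of \<open>inner (C e) (D (C e))\<close> and \<open>inner (C e) (C (D e))\<close>.\<close>
  have adj_plus: "cinner ((C + (D o\<^sub>L C)) x) y = cinner x ((C + (C o\<^sub>L D)) y)" for x y
    by (simp add: plus_blinfun.rep_eq cinner_add_left cinner_add_right
        selfadjoint_opD[OF C] selfadjoint_opD[OF D'])
  have adj_minus: "cinner ((C - (D o\<^sub>L C)) x) y = cinner x ((C - (C o\<^sub>L D)) y)" for x y
    by (simp add: minus_blinfun.rep_eq cinner_diff_left cinner_diff_right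
        selfadjoint_opD[OF C] selfadjoint_opD[OF D'])
  have summable: "(\<lambda>e. (norm (K e))\<^sup>2) summable_on E"
    if K: "\<And>x. norm (K x) \<le> (1 + norm D) * norm (C x)" for K :: "'a \<Rightarrow> 'a"
  proof (rule summable_on_comparison_test)
    show "(\<lambda>e. (1 + norm D)\<^sup>2 * (norm (C e))\<^sup>2) summable_on E"
      by (intro summable_on_cmult_right hs)
    show "(norm (K e))\<^sup>2 \<le> (1 + norm D)\<^sup>2 * (norm (C e))\<^sup>2" for e
      using power_mono[OF K[of e], of 2] by (simp add: power_mult_distrib)
  qed auto
  have bound: "norm (C x + D (C x)) \<le> (1 + norm D) * norm (C x)"
    "norm (C x - D (C x)) \<le> (1 + norm D) * norm (C x)" for x
    using norm_triangle_ineq[of "C x" "D (C x)"] norm_triangle_ineq4[of "C x" "D (C x)"]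
      norm_blinfun[of D "C x"] by (auto simp: algebra_simps)
  obtain a where a: "((\<lambda>e. (norm ((C + (D o\<^sub>L C)) e))\<^sup>2) has_sum a) E"
    using summable[OF bound(1)] by (auto simp: summable_on_def plus_blinfun.rep_eq)
  obtain b where b: "((\<lambda>e. (norm ((C - (D o\<^sub>L C)) e))\<^sup>2) has_sum b) E"
    using summable[OF bound(2)] by (auto simp: summable_on_def minus_blinfun.rep_eq)
  have "((\<lambda>e. inner (C e) (D (C e))) has_sum (a - b) / 4) E"
    using a b by (intro has_sum_inner_polarization)
      (simp_all add: plus_blinfun.rep_eq minus_blinfun.rep_eq)
  \<comment> \<open>In this order of the factors every single term is nonnegative; after the cyclic
    move only the sum is known to be.\<close>
  then have "0 \<le> (a - b) / 4"
    by (rule has_sum_nonneg) (rule positive_op_inner[OF D])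
  moreover have "((\<lambda>e. inner (C e) (C (D e))) has_sum (a - b) / 4) E"
    using has_sum_norm_square_adjoint[OF adj_plus E E a] has_sum_norm_square_adjoint[OF adj_minus E E b]
    by (intro has_sum_inner_polarization) (simp_all add: plus_blinfun.rep_eq minus_blinfun.rep_eq)
  then have "((\<lambda>e. inner (C (C e)) (D e)) has_sum (a - b) / 4) E"
    by (simp add: selfadjoint_op_inner[OF C])
  ultimately show ?thesis by blast
qed

section \<open>Square roots and powers of trace class operators\<close>

lemma op_powr_half_square: "positive_op T \<Longrightarrow> op_powr T (1/2) o\<^sub>L op_powr T (1/2) = T"
  using op_powr_add[of T "1/2" "1/2"] by (simp add: op_powr_one)

lemma norm_op_powr_square:
  assumes T: "positive_op T" and "0 < s"
  shows "(norm (op_powr T s v))\<^sup>2 = inner v (op_powr T (2 * s) v)"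
proof -
  have "op_powr T (2 * s) = op_powr T s o\<^sub>L op_powr T s"
    using op_powr_add[OF T, of s s] assms(2) by simp
  then show ?thesis
    by (simp add: power2_norm_eq_inner
        selfadjoint_op_inner[OF positive_op_imp_selfadjoint[OF positive_op_powr[OF T \<open>0 < s\<close>]]])
qed

text \<open>For \<open>s > 1\<close> split T^s as T^(1/2) T^(s-1) T^(1/2): its form is at most the
  norm of T^(s-1) times the form of \<open>T\<close>.\<close>

lemma summable_on_op_powr:
  fixes T :: "'a::complex_hilbert_space \<Rightarrow>\<^sub>L 'a"
  assumes T: "positive_op T" and s: "1 \<le> s" and sum: "(\<lambda>e. inner e (T e)) summable_on E"
  shows "(\<lambda>e. inner e (op_powr T s e)) summable_on E"
proof (cases "s = 1")
  case True
  with sum show ?thesis by (simp add: op_powr_one[OF T])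
next
  case False
  let ?C = "op_powr T (1/2)" and ?K = "op_powr T (s - 1)"
  have C: "selfadjoint_op ?C"
    by (intro positive_op_imp_selfadjoint positive_op_powr T) simp
  have "op_powr T s = ?C o\<^sub>L (?K o\<^sub>L ?C)"
    using s False by (simp add: op_powr_add T)
  then have "inner e (op_powr T s e) = inner (?C e) (?K (?C e))" for e
    by (simp add: selfadjoint_op_inner[OF C])
  also have "inner (?C e) (?K (?C e)) \<le> norm (?C e) * (norm ?K * norm (?C e))" for e
    by (intro order_trans[OF norm_cauchy_schwarz] mult_left_mono norm_blinfun) auto
  also have "norm (?C e) * (norm ?K * norm (?C e)) = norm ?K * inner e (T e)" for e
    using norm_op_powr_square[OF T, of "1/2" e]
    by (simp add: op_powr_one[OF T] power2_eq_square mult_ac)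
  finally have "inner e (op_powr T s e) \<le> norm ?K * inner e (T e)" for e .
  then show ?thesis
    using s by (intro summable_on_comparison_test[OF summable_on_cmult_right[OF sum, of "norm ?K"]]
        positive_op_inner positive_op_powr T) auto
qed

text \<open>Summability is known only in the basis witnessing trace class. The diagonal entries are
  the squared norms of the images under T^(1/2), so the summability moves to any other
  basis.\<close>

lemma trace_class_summable_on:
  fixes T :: "'a::complex_hilbert_space \<Rightarrow>\<^sub>L 'a"
  assumes T: "positive_op T" "trace_class T" and E: "onb E"
  shows "(\<lambda>e. inner e (T e)) summable_on E"
proof -
  obtain F where F: "onb F" "(\<lambda>e. cinner e (T e)) summable_on F"
    using T by (auto simp: trace_class_def op_abs_positive)
  let ?C = "op_powr T (1/2)"
  have C: "selfadjoint_op ?C"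
    by (intro positive_op_imp_selfadjoint positive_op_powr T) simp
  have sq: "inner e (T e) = (norm (?C e))\<^sup>2" for e
    using norm_op_powr_square[OF T(1), of "1/2" e] by (simp add: op_powr_one[OF T(1)])
  have "(\<lambda>e. Re (cinner e (T e))) summable_on F"
    by (intro summable_on_bounded_linear[OF bounded_linear_Re] F)
  then obtain c where "((\<lambda>e. (norm (?C e))\<^sup>2) has_sum c) F"
    by (auto simp: summable_on_def sq simp flip: inner_eq_Re_cinner)
  then have "((\<lambda>e. (norm (?C e))\<^sup>2) has_sum c) E"
    by (rule has_sum_norm_square_adjoint[OF selfadjoint_opD[OF C] F(1) E])
  then show ?thesis
    by (simp add: sq has_sum_imp_summable)
qed

section \<open>Monotonicity along the power means\<close>

lemma summable_on_norm_square_diff: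
  fixes f g :: "'b \<Rightarrow> 'a::real_inner"
  assumes "(\<lambda>e. (norm (f e))\<^sup>2) summable_on E" "(\<lambda>e. (norm (g e))\<^sup>2) summable_on E"
  shows "(\<lambda>e. (norm (f e - g e))\<^sup>2) summable_on E"
proof (rule summable_on_comparison_test)
  show "(\<lambda>e. 2 * ((norm (f e))\<^sup>2 + (norm (g e))\<^sup>2)) summable_on E"
    by (intro summable_on_cmult_right summable_on_add assms)
  have "(norm (x - y))\<^sup>2 + (norm (x + y))\<^sup>2 = 2 * ((norm x)\<^sup>2 + (norm y)\<^sup>2)" for x y :: 'a
    unfolding power2_norm_eq_inner
    by (simp add: inner_add_left inner_add_right inner_diff_left inner_diff_right inner_commute)
  then show "(norm (f e - g e))\<^sup>2 \<le> 2 * ((norm (f e))\<^sup>2 + (norm (g e))\<^sup>2)" for e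
    by (metis le_add_same_cancel1 zero_le_power2)
qed auto

text \<open>The convexity inequality at one vector, on the segment from \<open>Y\<close> to
  \<open>Z\<close>. The endpoint \<open>Z\<close> contributes a zero distance, which is why only the
  weight \<open>1 - l\<close> appears. In the expanded square, the norm of
  \<open>op_powr X q v\<close> is controlled by convexity of the power \<open>2 * q\<close>; in the
  mixed term, \<open>op_powr X q\<close> is replaced exactly by the chord plus the defect
  \<open>D\<close>, because operator concavity gives no sign to
  \<open>inner (op_powr Z q v) (D v)\<close> at a single \<open>v\<close>.\<close>

lemma norm_square_diff_op_powr_convex_combination:
  fixes Y Z :: "'a::complex_hilbert_space \<Rightarrow>\<^sub>L 'a"
  assumes Y: "positive_op Y" and Z: "positive_op Z" and l: "0 \<le> l" "l \<le> 1"
    and q: "1/2 \<le> q" "q \<le> 1"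
  defines "X \<equiv> (1 - l) *\<^sub>R Y + l *\<^sub>R Z"
  defines "D \<equiv> op_powr X q - ((1 - l) *\<^sub>R op_powr Y q + l *\<^sub>R op_powr Z q)"
  shows "positive_op D"
    and "(norm (op_powr Z q v - op_powr X q v))\<^sup>2 \<le>
      (1 - l) * (norm (op_powr Z q v - op_powr Y q v))\<^sup>2 - 2 * inner (op_powr Z q v) (D v)"
proof -
  have X: "positive_op X"
    unfolding X_def by (rule positive_op_convex_combination[OF Y Z l])
  show "positive_op D"
  proof (rule positive_opI)
    show "selfadjoint_op D"
      unfolding D_def using X Y Z q
      by (intro selfadjoint_op_diff selfadjoint_op_add selfadjoint_op_scaleR
          positive_op_imp_selfadjoint positive_op_powr) auto
    show "0 \<le> inner x (D x)" for x
      using op_powr_concave[OF Y Z l, of q x] q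
      by (simp add: D_def X_def minus_blinfun.rep_eq plus_blinfun.rep_eq scaleR_blinfun.rep_eq
          inner_diff_right inner_add_right)
  qed
  have convex: "(norm (op_powr X q v))\<^sup>2 \<le> (1 - l) * (norm (op_powr Y q v))\<^sup>2 + l * (norm (op_powr Z q v))\<^sup>2"
    using op_powr_convex[OF Y Z l, of "2 * q" v] X Y Z q
    by (simp add: norm_op_powr_square X_def)
  have expand: "(norm (a - m))\<^sup>2 = (norm a)\<^sup>2 - 2 * inner a m + (norm m)\<^sup>2" for a m :: 'a
    unfolding power2_norm_eq_inner by (simp add: inner_diff_left inner_diff_right inner_commute)
  have inner_D: "inner a (D v) = inner a (op_powr X q v) - (1 - l) * inner a (op_powr Y q v)
      - l * inner a (op_powr Z q v)" for a
    by (simp add: D_def minus_blinfun.rep_eq plus_blinfun.rep_eq scaleR_blinfun.rep_eq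
        inner_diff_right inner_add_right)
  show "(norm (op_powr Z q v - op_powr X q v))\<^sup>2 \<le>
      (1 - l) * (norm (op_powr Z q v - op_powr Y q v))\<^sup>2 - 2 * inner (op_powr Z q v) (D v)"
    unfolding expand inner_D dot_square_norm using convex by (simp add: algebra_simps)
qed

theorem theorem1:
  fixes A B :: "'a::complex_hilbert_space \<Rightarrow>\<^sub>L 'a"
    and p :: real
  assumes "positive_op A" and "trace_class A"
    and "positive_op B" and "trace_class B"
    and "1 \<le> p" and "p \<le> 2"
  shows "antimono_on {0..1} (\<lambda>t. Re (op_trace (op_power (A - power_mean p A B t) 2)))"
proof (rule monotone_onI)
  fix s t :: real
  assume st: "s \<in> {0..1}" "t \<in> {0..1}" "s \<le> t"
  note A = assms(1) and B = assms(3) and p = assms(5,6)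
  define q where "q = 1 / p"
  have q: "1/2 \<le> q" "q \<le> 1" "0 < q" using p by (auto simp: q_def field_simps)
  define X where "X r = r *\<^sub>R op_powr A p + (1 - r) *\<^sub>R op_powr B p" for r
  define M where "M r = op_powr (X r) q" for r
  have M: "power_mean p A B r = M r" for r
    by (simp add: power_mean_def M_def X_def q_def)
  \<comment> \<open>The trace class hypothesis itself supplies an orthonormal basis.\<close>
  obtain E :: "'a set" where E: "onb E"
    using assms(2) unfolding trace_class_def by blast
  have Ap: "positive_op (op_powr A p)" and Bp: "positive_op (op_powr B p)"
    using p by (auto intro!: positive_op_powr A B)
  have X: "positive_op (X r)" if "r \<in> {0..1}" for r
    unfolding X_def using that by (intro positive_op_add positive_op_scaleR Ap Bp) auto
  have X_sum: "(\<lambda>e. inner e (X r e)) summable_on E" for r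
  proof -
    have "(\<lambda>e. r * inner e (op_powr A p e) + (1 - r) * inner e (op_powr B p e)) summable_on E"
      by (intro summable_on_add summable_on_cmult_right summable_on_op_powr
          trace_class_summable_on assms E)
    then show ?thesis
      by (simp add: X_def plus_blinfun.rep_eq scaleR_blinfun.rep_eq inner_add_right)
  qed
  \<comment> \<open>The summands are the diagonal entries of the power \<open>2 * q\<close> of
    \<open>X r\<close>; as this exponent is at least 1, they are summable along with those of
    \<open>X r\<close>.\<close>
  have M_sum: "(\<lambda>e. (norm (M r e))\<^sup>2) summable_on E" if "r \<in> {0..1}" for r
    unfolding M_def norm_op_powr_square[OF X[OF that] q(3)]
    using q by (intro summable_on_op_powr X[OF that] X_sum) auto
  have A_eq: "M 1 = A"
    using p by (simp add: M_def X_def q_def op_powr_powr[OF A] op_powr_one[OF A])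
  have A_sum: "(\<lambda>e. (norm (A e))\<^sup>2) summable_on E"
    using M_sum[of 1] by (simp add: A_eq)
  define f where "f r = infsum (\<lambda>e. (norm (A e - M r e))\<^sup>2) E" for r
  have f: "((\<lambda>e. (norm (A e - M r e))\<^sup>2) has_sum f r) E" if "r \<in> {0..1}" for r
    unfolding f_def
    by (intro has_sum_infsum summable_on_norm_square_diff A_sum M_sum that)
  have trace: "Re (op_trace (op_power (A - power_mean p A B r) 2)) = f r" if "r \<in> {0..1}" for r
  proof -
    have "selfadjoint_op (A - M r)"
      unfolding M_def
      by (intro selfadjoint_op_diff positive_op_imp_selfadjoint A positive_op_powr X that q)
    then show ?thesis
      using op_trace_square[OF _ E, of "A - M r" "f r"] f[OF that]
      by (simp add: M minus_blinfun.rep_eq)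
  qed
  have f_nonneg: "0 \<le> f s"
    by (rule has_sum_nonneg[OF f[OF st(1)]]) simp
  have "f t \<le> f s"
  proof (cases "s = t")
    case False
    \<comment> \<open>The position of \<open>t\<close> between \<open>s\<close> and 1, so that
      \<open>X t\<close> lies on the segment from \<open>X s\<close> to
      \<open>X 1 = op_powr A p\<close>. Here \<open>s < t \<le> 1\<close>, hence the denominator is
      positive.\<close>
    define l where "l = (t - s) / (1 - s)"
    have l: "0 \<le> l" "l \<le> 1" and l_eq: "l * (1 - s) = t - s"
      using st False by (auto simp: l_def field_simps)
    have Xt: "X t = (1 - l) *\<^sub>R X s + l *\<^sub>R op_powr A p"
    proof -
      have "(1 - l) * s + l = t" "(1 - l) * (1 - s) = 1 - t"
        using l_eq by (auto simp: algebra_simps)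
      then show ?thesis
        unfolding X_def scaleR_add_right scaleR_scaleR
        by (metis (no_types, lifting) add.commute add.left_commute scaleR_add_left)
    qed
    have Z: "op_powr (op_powr A p) q = A"
      using A_eq by (simp add: M_def X_def)
    define D where "D = M t - ((1 - l) *\<^sub>R M s + l *\<^sub>R A)"
    note conv = norm_square_diff_op_powr_convex_combination[OF X[OF st(1)] Ap l q(1,2),
        unfolded Xt[symmetric] Z M_def[symmetric] D_def[symmetric]]
    \<comment> \<open>The factor to be moved cyclically: its basis images are square summable
      because \<open>A\<close> is trace class, and \<open>?C\<close> applied twice is
      \<open>A\<close>.\<close>
    let ?C = "op_powr A (1/2)"
    have CC: "?C (?C v) = A v" for v
      using op_powr_half_square[OF A] by (metis blinfun_apply_blinfun_compose)
    have C: "positive_op ?C" by (intro positive_op_powr A) simp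
    have "(\<lambda>e. (norm (?C e))\<^sup>2) summable_on E"
      using trace_class_summable_on[OF assms(1,2) E]
      by (simp add: norm_op_powr_square[OF A] op_powr_one[OF A])
    from has_sum_inner_square_nonneg[OF positive_op_imp_selfadjoint[OF C] conv(1) E this]
    obtain r where r: "0 \<le> r" "((\<lambda>e. inner (A e) (D e)) has_sum r) E"
      by (auto simp: CC)
    have "((\<lambda>e. (1 - l) * (norm (A e - M s e))\<^sup>2 + - (2 * inner (A e) (D e))) has_sum
        (1 - l) * f s + - (2 * r)) E"
      by (intro has_sum_add has_sum_uminusI has_sum_cmult_right f st r)
    then have "f t \<le> (1 - l) * f s + - (2 * r)"
      by (rule has_sum_mono[OF f[OF st(2)]]) (use conv(2) in simp)
    \<comment> \<open>Convexity becomes monotonicity here: the endpoint 1 contributes nothing to the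
      chord, and both \<open>l * f s\<close> and \<open>2 * r\<close> are nonnegative.\<close>
    also have "\<dots> \<le> f s"
      using r(1) l f_nonneg by (simp add: algebra_simps mult_nonneg_nonneg add_nonneg_nonneg)
    finally show ?thesis .
  qed simp
  then show "Re (op_trace (op_power (A - power_mean p A B t) 2)) \<le>
      Re (op_trace (op_power (A - power_mean p A B s) 2))"
    by (simp only: trace[OF st(1)] trace[OF st(2)])
qed

end
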